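(* Consider a project (as defined in the context) that is PCL-indexable, i.e., satisfies: (PCLI1) $g(x,z)>0$ for every $x\in\mathsf X$ and $z\in\overline{\mathbb R}$; (PCLI2) the MP index $m(x)=f(x,x)/g(x,x)$ is nondecreasing and continuous on $\mathsf X$; (PCLI3) for every $x\in\mathsf X$ and all $-\infty<z_1<z_2<\infty$, $F(x,z_2)-F(x,z_1)=\int_{(z_1,z_2]} m(z)\,G(x,dz)$. Let $\nu_0\in\mathbb P_w(\mathsf X)$. Then the finite signed measure $\nu_{F(\nu_0,\cdot)}$ is absolutely continuous with respect to the finite measure $\nu_{G(\nu_0,\cdot)}$, with $m(\cdot)$ being a Radon–Nikodym derivative of $\nu_{F(\nu_0,\cdot)}$ with respect to $\nu_{G(\nu_0,\cdot)}$, viz., $$\nu_{F(\nu_0,\cdot)}(S)=\int_S m(x)\,\nu_{G(\nu_0,\cdot)}(dx),\qquad S\in\mathcal B(\mathbb R).$$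
   Context: Project model. $\mathsf X=\{x\in\mathbb R:\ell\le x\le u\}$ with $-\infty\le\ell<u\le\infty$; all sets and functions are Borel measurable. A project has state $X_t\in\mathsf X$ and action $A_t\in\{0,1\}$ ($1$ = active, $0$ = passive) at times $t=0,1,\dots$. When $(X_t,A_t)=(x,a)$ it yields reward $r(x,a)$, consumes $c(x,a)$ units of a resource, and $X_{t+1}\sim\kappa^a(x,\cdot)$, with $\kappa^0,\kappa^1$ Markov transition kernels on $\mathsf X$. The discount factor is $\beta\in[0,1)$. Standing assumption: for each $a\in\{0,1\}$, $r(\cdot,a)$ and $c(\cdot,a)$ are continuous on $\mathsf X$, $0\le c(x,0)<c(x,1)$ for all $x$, and there are a function $w:\mathsf X\to[1,\infty)$ and constants $M>0$, $\beta\le\gamma<1$ with $\max\{|r(x,a)|,c(x,a)\}\le M w(x)$ and $\beta\int w(y)\,\kappa^a(x,dy)\le\gamma w(x)$ for all $x,a$. $\mathbb P_w(\mathsf X)$ is the set of probability measures $\nu_0$ on $\mathsf X$ with $\int w\,d\nu_0<\infty$. Policies and metrics. For a nonanticipative policy $\pi$ and $X_0\sim\nu_0$, $F(\nu_0,\pi)=\mathsf E_{\nu_0}^\pi[\sum_{t\ge0}\beta^t r(X_t,A_t)]$, $G(\nu_0,\pi)=\mathsf E_{\nu_0}^\pi[\sum_{t\ge0}\beta^t c(X_t,A_t)]$, written $F(x,\pi),G(x,\pi)$ when $\nu_0=\delta_x$. For $z\in\overline{\mathbb R}=\mathbb R\cup\{-\infty,\infty\}$ the $z$-policy takes $A_t=1$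 iff $X_t>z$; its metrics are $F(\nu_0,z),G(\nu_0,z)$. For an action $a$ and a policy $\pi$, $\langle a,\pi\rangle$ takes action $a$ at time $0$ and follows $\pi$ afterwards. $f(x,\pi)=F(x,\langle1,\pi\rangle)-F(x,\langle0,\pi\rangle)$, $g(x,\pi)=G(x,\langle1,\pi\rangle)-G(x,\langle0,\pi\rangle)$; $f(x,z),g(x,z)$ are these for the $z$-policy. The integral in (PCLI3) is a Lebesgue–Stieltjes integral with respect to $z\mapsto G(x,z)$ on $\mathbb R$ (mass $G(x,b)-G(x,a)$ on $(a,b]$). $m$ is extended to $\mathbb R$ by $m(z)=m(\ell)$ for $z<\ell$ and $m(z)=m(u)$ for $z>u$. Induced measures. Under PCL-indexability, $G(\nu_0,\cdot)$ is bounded, right-continuous and nonincreasing on $\mathbb R$, and $F(\nu_0,\cdot)$ is bounded, right-continuous with left limits, and of bounded variation on $\mathbb R$. $\nu_{G(\nu_0,\cdot)}$ is the unique finite measure and $\nu_{F(\nu_0,\cdot)}$ the unique finite signed measure on $\mathcal B(\mathbb R)$ with $\nu_{G(\nu_0,\cdot)}(z_1,z_2]=G(\nu_0,z_1)-G(\nu_0,z_2)$ and $\nu_{F(\nu_0,\cdot)}(z_1,z_2]=F(\nu_0,z_1)-F(\nu_0,z_2)$ for all $-\infty<z_1<z_2<\infty$. *)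

theory Defs
  imports "HOL-Probability.Probability"
begin

section \<open>Projects, policies and their metrics\<close>

text \<open>Actions are booleans: \<^term>\<open>True\<close> is active, \<^term>\<open>False\<close> is passive.\<close>

record project =
  lower :: ereal
  upper :: ereal
  reward :: "real \<Rightarrow> bool \<Rightarrow> real"
  resource :: "real \<Rightarrow> bool \<Rightarrow> real"
  transition :: "bool \<Rightarrow> real \<Rightarrow> real measure"
  discount :: real

definition states :: "project \<Rightarrow> real set" where
  "states P = {x. lower P \<le> ereal x \<and> ereal x \<le> upper P}"

definition state_space :: "project \<Rightarrow> real measure" where
  "state_space P = restrict_space borel (states P)"

definition pair_space :: "project \<Rightarrow> (real \<times> bool) measure" where
  "pair_space P = state_space P \<Otimes>\<^sub>M count_space UNIV"

definition standing_assumption :: "project \<Rightarrow> (real \<Rightarrow> real) \<Rightarrow> real \<Rightarrow> real \<Rightarrow> bool" where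
  "standing_assumption P w M \<gamma> \<longleftrightarrow>
     lower P < upper P \<and> 0 \<le> discount P \<and> discount P < 1 \<and>
     (\<forall>a. transition P a \<in> state_space P \<rightarrow>\<^sub>M prob_algebra (state_space P)) \<and>
     (\<forall>a. continuous_on (states P) (\<lambda>x. reward P x a) \<and>
          continuous_on (states P) (\<lambda>x. resource P x a)) \<and>
     (\<forall>x\<in>states P. 0 \<le> resource P x False \<and> resource P x False < resource P x True) \<and>
     w \<in> borel_measurable (state_space P) \<and> (\<forall>x\<in>states P. 1 \<le> w x) \<and>
     0 < M \<and> discount P \<le> \<gamma> \<and> \<gamma> < 1 \<and>
     (\<forall>x\<in>states P. \<forall>a.
        max \<bar>reward P x a\<bar> (resource P x a) \<le> M * w x \<and>
        ennreal (discount P) * (\<integral>\<^sup>+ y. ennreal (w y) \<partial>transition P a x) \<le> ennreal (\<gamma> * w x))"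

definition prob_w :: "project \<Rightarrow> (real \<Rightarrow> real) \<Rightarrow> real measure set" where
  "prob_w P w = {\<nu> \<in> space (prob_algebra (state_space P)). (\<integral>\<^sup>+ x. ennreal (w x) \<partial>\<nu>) < \<infinity>}"

text \<open>
  A history-dependent randomized policy: \<open>\<pi> n h x\<close> is the law of the action at time \<open>n\<close> given the
  state \<open>x\<close> at time \<open>n\<close> and the state-action pairs \<open>h i\<close> at the times \<open>i < n\<close>.
\<close>
type_synonym policy = "nat \<Rightarrow> (nat \<Rightarrow> real \<times> bool) \<Rightarrow> real \<Rightarrow> bool pmf"

definition nonanticipative :: "project \<Rightarrow> policy \<Rightarrow> bool" where
  "nonanticipative P \<pi> \<longleftrightarrow>
     (\<forall>n a. (\<lambda>(h, x). pmf (\<pi> n h x) a)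
        \<in> borel_measurable (PiM {0..<n} (\<lambda>_. pair_space P) \<Otimes>\<^sub>M state_space P))"

definition threshold :: "ereal \<Rightarrow> policy" where
  "threshold z = (\<lambda>n h x. return_pmf (z < ereal x))"

text \<open>From time 1 on, \<open>\<pi>\<close> is run as if the process had started at time 1.\<close>
definition first_then :: "bool \<Rightarrow> policy \<Rightarrow> policy" where
  "first_then a \<pi> = (\<lambda>n h x. case n of
      0 \<Rightarrow> return_pmf a
    | Suc k \<Rightarrow> \<pi> k (\<lambda>i\<in>{0..<k}. h (Suc i)) x)"

definition action_step :: "project \<Rightarrow> (real \<Rightarrow> bool pmf) \<Rightarrow> real \<Rightarrow> (real \<times> bool) measure" where
  "action_step P p x = distr (measure_pmf (p x)) (pair_space P) (\<lambda>a. (x, a))"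

text \<open>The conditional law of the state-action pair at time \<open>n\<close>, given the earlier pairs.\<close>
definition step_law ::
    "project \<Rightarrow> real measure \<Rightarrow> policy \<Rightarrow> nat \<Rightarrow> (nat \<Rightarrow> real \<times> bool) \<Rightarrow> (real \<times> bool) measure" where
  "step_law P \<nu> \<pi> n h =
     (case n of 0 \<Rightarrow> \<nu> | Suc k \<Rightarrow> transition P (snd (h k)) (fst (h k))) \<bind> action_step P (\<pi> n h)"

text \<open>
  The law of the whole state-action trajectory (Ionescu-Tulcea theorem), see the lemma
  \<open>Ionescu_Tulcea_step_law\<close> below.
\<close>
definition path_law :: "project \<Rightarrow> real measure \<Rightarrow> policy \<Rightarrow> (nat \<Rightarrow> real \<times> bool) measure" where
  "path_law P \<nu> \<pi> =
     projective_family.lim UNIV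
       (Ionescu_Tulcea.CI (step_law P \<nu> \<pi>) (\<lambda>_. pair_space P)) (\<lambda>_. pair_space P)"

definition total_discounted ::
    "project \<Rightarrow> (real \<Rightarrow> bool \<Rightarrow> real) \<Rightarrow> real measure \<Rightarrow> policy \<Rightarrow> real" where
  "total_discounted P h \<nu> \<pi> =
     (\<integral>\<omega>. (\<Sum>t. discount P ^ t * h (fst (\<omega> t)) (snd (\<omega> t))) \<partial>path_law P \<nu> \<pi>)"

definition F_metric :: "project \<Rightarrow> real measure \<Rightarrow> policy \<Rightarrow> real" where
  "F_metric P \<nu> \<pi> = total_discounted P (reward P) \<nu> \<pi>"

definition G_metric :: "project \<Rightarrow> real measure \<Rightarrow> policy \<Rightarrow> real" where
  "G_metric P \<nu> \<pi> = total_discounted P (resource P) \<nu> \<pi>"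

abbreviation dirac :: "project \<Rightarrow> real \<Rightarrow> real measure" where
  "dirac P x \<equiv> return (state_space P) x"

definition f_marginal :: "project \<Rightarrow> real \<Rightarrow> policy \<Rightarrow> real" where
  "f_marginal P x \<pi> =
     F_metric P (dirac P x) (first_then True \<pi>) - F_metric P (dirac P x) (first_then False \<pi>)"

definition g_marginal :: "project \<Rightarrow> real \<Rightarrow> policy \<Rightarrow> real" where
  "g_marginal P x \<pi> =
     G_metric P (dirac P x) (first_then True \<pi>) - G_metric P (dirac P x) (first_then False \<pi>)"


section \<open>PCL-indexability\<close>

definition mp_index :: "project \<Rightarrow> real \<Rightarrow> real" where
  "mp_index P x = f_marginal P x (threshold (ereal x)) / g_marginal P x (threshold (ereal x))"

definition mp_index_ext :: "project \<Rightarrow> real \<Rightarrow> real" where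
  "mp_index_ext P z =
     (if ereal z < lower P then mp_index P (real_of_ereal (lower P))
      else if upper P < ereal z then mp_index P (real_of_ereal (upper P))
      else mp_index P z)"

text \<open>
  Lebesgue-Stieltjes integral with respect to a nonincreasing right-continuous \<open>G\<close>, which gives
  the mass \<open>G b - G a \<le> 0\<close> to \<open>(a, b]\<close>. It is applied below only to \<open>z \<mapsto> G(x,z)\<close>; that function
  is right-continuous by dominated convergence, and nonincreasing once all the marginal metrics
  \<open>g(x,z)\<close> are positive.
\<close>
definition stieltjes_integral_antimono :: "(real \<Rightarrow> real) \<Rightarrow> (real \<Rightarrow> real) \<Rightarrow> real set \<Rightarrow> real" where
  "stieltjes_integral_antimono G h S = - (LINT z:S|interval_measure (\<lambda>z. - G z). h z)"

definition PCL_indexable :: "project \<Rightarrow> bool" where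
  "PCL_indexable P \<longleftrightarrow>
     (\<forall>x\<in>states P. \<forall>z. 0 < g_marginal P x (threshold z)) \<and>
     (mono_on (states P) (mp_index P) \<and> continuous_on (states P) (mp_index P)) \<and>
     (\<forall>x\<in>states P. \<forall>z1 z2. z1 < z2 \<longrightarrow>
        F_metric P (dirac P x) (threshold (ereal z2)) - F_metric P (dirac P x) (threshold (ereal z1))
        = stieltjes_integral_antimono
            (\<lambda>z. G_metric P (dirac P x) (threshold (ereal z))) (mp_index_ext P) {z1<..z2})"


section \<open>Induced measures\<close>

text \<open>
  Only the values on \<^term>\<open>sets M\<close> matter; the value 0 elsewhere makes a signed measure with given
  values on \<^term>\<open>sets M\<close> unique as a function (the convention of \<^const>\<open>emeasure\<close>).
\<close>
definition finite_signed_measure :: "'a measure \<Rightarrow> ('a set \<Rightarrow> real) \<Rightarrow> bool" where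
  "finite_signed_measure M \<mu> \<longleftrightarrow>
     \<mu> {} = 0 \<and>
     (\<forall>A. range A \<subseteq> sets M \<longrightarrow> disjoint_family A \<longrightarrow> (\<lambda>i::nat. \<mu> (A i)) sums \<mu> (\<Union>i. A i)) \<and>
     (\<forall>S. S \<notin> sets M \<longrightarrow> \<mu> S = 0)"

definition abs_continuous_signed :: "'a measure \<Rightarrow> ('a set \<Rightarrow> real) \<Rightarrow> bool" where
  "abs_continuous_signed M \<mu> \<longleftrightarrow> (\<forall>S\<in>null_sets M. \<mu> S = 0)"

definition G_measure :: "project \<Rightarrow> real measure \<Rightarrow> real measure" where
  "G_measure P \<nu> = (THE \<mu>. sets \<mu> = sets borel \<and> finite_measure \<mu> \<and>
     (\<forall>z1 z2. z1 < z2 \<longrightarrow> measure \<mu> {z1<..z2} =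
        G_metric P \<nu> (threshold (ereal z1)) - G_metric P \<nu> (threshold (ereal z2))))"

definition F_measure :: "project \<Rightarrow> real measure \<Rightarrow> real set \<Rightarrow> real" where
  "F_measure P \<nu> = (THE \<mu>. finite_signed_measure borel \<mu> \<and>
     (\<forall>z1 z2. z1 < z2 \<longrightarrow> \<mu> {z1<..z2} =
        F_metric P \<nu> (threshold (ereal z1)) - F_metric P \<nu> (threshold (ereal z2))))"


section \<open>Well-posedness of the trajectory law\<close>

lemma nonanticipative_threshold: "nonanticipative P (threshold z)"
proof -
  have [measurable]: "{x. z < ereal x} \<in> sets borel"
    by measurable
  have [measurable]: "Measurable.pred (state_space P) (\<lambda>x. z < ereal x)"
    unfolding state_space_def by (intro measurable_restrict_space1) measurable
  show ?thesis
    unfolding nonanticipative_def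
  proof (intro allI)
    fix n a
    have "pmf (threshold z n h x) a = (if (z < ereal x) = a then 1 else 0)" for h x
      by (auto simp: threshold_def)
    then show "(\<lambda>(h, x). pmf (threshold z n h x) a)
        \<in> borel_measurable (PiM {0..<n} (\<lambda>_. pair_space P) \<Otimes>\<^sub>M state_space P)"
      by simp
  qed
qed

lemma nonanticipative_first_then:
  assumes "nonanticipative P \<pi>"
  shows "nonanticipative P (first_then a \<pi>)"
  unfolding nonanticipative_def
proof (intro allI)
  fix n b
  show "(\<lambda>(h, x). pmf (first_then a \<pi> n h x) b)
      \<in> borel_measurable (PiM {0..<n} (\<lambda>_. pair_space P) \<Otimes>\<^sub>M state_space P)"
  proof (cases n)
    case 0
    then show ?thesis by (simp add: first_then_def)
  next
    case (Suc k)
    have "(\<lambda>(h, x). pmf (\<pi> k h x) b)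
        \<in> borel_measurable (PiM {0..<k} (\<lambda>_. pair_space P) \<Otimes>\<^sub>M state_space P)"
      using assms by (auto simp: nonanticipative_def)
    moreover have "(\<lambda>hx. (\<lambda>i\<in>{0..<k}. fst hx (Suc i), snd hx))
        \<in> PiM {0..<Suc k} (\<lambda>_. pair_space P) \<Otimes>\<^sub>M state_space P
          \<rightarrow>\<^sub>M PiM {0..<k} (\<lambda>_. pair_space P) \<Otimes>\<^sub>M state_space P"
      by (intro measurable_Pair measurable_restrict measurable_snd
          measurable_compose[OF measurable_fst measurable_component_singleton]) auto
    ultimately have "(\<lambda>hx. pmf (\<pi> k (\<lambda>i\<in>{0..<k}. fst hx (Suc i)) (snd hx)) b)
        \<in> borel_measurable (PiM {0..<Suc k} (\<lambda>_. pair_space P) \<Otimes>\<^sub>M state_space P)"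
      by (subst (asm) measurable_split_conv) (drule (1) measurable_compose[rotated], simp)
    then show ?thesis
      by (simp add: Suc first_then_def case_prod_beta')
  qed
qed

lemma Ionescu_Tulcea_step_law:
  assumes "standing_assumption P w M \<gamma>"
    and "\<nu> \<in> space (prob_algebra (state_space P))"
    and "nonanticipative P \<pi>"
  shows "Ionescu_Tulcea (step_law P \<nu> \<pi>) (\<lambda>_. pair_space P)"
proof -
  have "step_law P \<nu> \<pi> n \<in> PiM {0..<n} (\<lambda>_. pair_space P) \<rightarrow>\<^sub>M prob_algebra (pair_space P)" for n
  proof -
    let ?H = "PiM {0..<n} (\<lambda>_. pair_space P)"
    have kernel: "(\<lambda>(a, x). transition P a x) \<in>
        count_space UNIV \<Otimes>\<^sub>M state_space P \<rightarrow>\<^sub>M prob_algebra (state_space P)"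
      using assms(1)
      by (intro measurable_pair_measure_countable1) (auto simp: standing_assumption_def)
    have prev: "(\<lambda>h. case n of 0 \<Rightarrow> \<nu> | Suc k \<Rightarrow> transition P (snd (h k)) (fst (h k)))
        \<in> ?H \<rightarrow>\<^sub>M prob_algebra (state_space P)"
    proof (cases n)
      case 0
      then show ?thesis using assms(2) by simp
    next
      case (Suc k)
      have "(\<lambda>h. h k) \<in> ?H \<rightarrow>\<^sub>M state_space P \<Otimes>\<^sub>M count_space UNIV"
        unfolding Suc by (subst pair_space_def[symmetric], rule measurable_component_singleton) simp
      then have "(\<lambda>h. (snd (h k), fst (h k))) \<in> ?H \<rightarrow>\<^sub>M count_space UNIV \<Otimes>\<^sub>M state_space P"
        by measurable
      from measurable_compose[OF this kernel] show ?thesis by (simp add: Suc)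
    qed
    have act: "(\<lambda>hx. measure_pmf (\<pi> n (fst hx) (snd hx)))
        \<in> ?H \<Otimes>\<^sub>M state_space P \<rightarrow>\<^sub>M prob_algebra (count_space UNIV)"
    proof (rule measurable_prob_algebraI)
      show "(\<lambda>hx. measure_pmf (\<pi> n (fst hx) (snd hx)))
          \<in> ?H \<Otimes>\<^sub>M state_space P \<rightarrow>\<^sub>M subprob_algebra (count_space UNIV)"
      proof (rule measurable_subprob_algebra)
        fix A :: "bool set"
        have "emeasure (measure_pmf p) A = (\<Sum>a\<in>A. ennreal (pmf p a))" for p
          by (simp add: emeasure_measure_pmf_finite)
        moreover have "(\<lambda>hx. pmf (\<pi> n (fst hx) (snd hx)) a)
            \<in> borel_measurable (?H \<Otimes>\<^sub>M state_space P)" for a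
          using assms(3) by (simp add: nonanticipative_def case_prod_beta')
        ultimately show "(\<lambda>hx. emeasure (measure_pmf (\<pi> n (fst hx) (snd hx))) A)
            \<in> borel_measurable (?H \<Otimes>\<^sub>M state_space P)"
          by simp
      qed (simp_all add: subprob_space_measure_pmf)
    qed (simp add: prob_space_measure_pmf)
    have "(\<lambda>hx. action_step P (\<pi> n (fst hx)) (snd hx))
        \<in> ?H \<Otimes>\<^sub>M state_space P \<rightarrow>\<^sub>M prob_algebra (pair_space P)"
      unfolding action_step_def
      by (rule measurable_distr_prob_space2[OF act]) (simp add: pair_space_def)
    then have "(\<lambda>(h, x). action_step P (\<pi> n h) x)
        \<in> ?H \<Otimes>\<^sub>M state_space P \<rightarrow>\<^sub>M prob_algebra (pair_space P)"
      by (simp add: case_prod_beta')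
    from measurable_bind_prob_space2[OF prev this] show ?thesis
      unfolding step_law_def[abs_def] .
  qed
  note K = this
  show ?thesis
  proof (rule Ionescu_Tulcea.intro)
    show "step_law P \<nu> \<pi> n \<in> PiM {0..<n} (\<lambda>_. pair_space P) \<rightarrow>\<^sub>M subprob_algebra (pair_space P)" for n
      by (rule measurable_prob_algebraD[OF K])
    show "prob_space (step_law P \<nu> \<pi> n h)" if "h \<in> space (PiM {0..<n} (\<lambda>_. pair_space P))" for n h
      using measurable_space[OF K that] by (simp add: space_prob_algebra)
  qed
qed

end

theory Submission
  imports Defs
begin

text \<open>
  Under the threshold policy \<open>z\<close> the state-action pair moves by a Markov kernel, so the metrics are
  integrals of a function \<open>q\<close> with \<open>q = f + \<beta> \<kappa> q\<close>, where \<open>f\<close> is the reward or the resource. For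
  \<open>z1 \<le> z2\<close> the difference \<open>D(x) = G(x,z1) - G(x,z2)\<close> satisfies
  \<open>D(x) = 1{z1 < x \<le> z2} g(x,z2) + \<beta> \<integral>D d\<kappa>\<close> with \<open>\<kappa>\<close> controlled by \<open>z1\<close>. Since \<open>g > 0\<close> and
  \<open>\<beta> \<kappa>\<close> contracts the \<open>w\<close>-norm, \<open>D \<ge> 0\<close>; and when \<open>z2\<close> decreases to \<open>z1\<close>, the limit of \<open>D\<close>
  solves the homogeneous equation and so vanishes. Hence \<open>- G(x,\<cdot>)\<close> generates a measure for each \<open>x\<close>,
  and \<open>\<nu>\<^bsub>G(\<nu>0,\<cdot>)\<^esub>\<close> is the \<open>\<nu>0\<close>-mixture of these measures. As \<open>m\<close> is nondecreasing, (PCLI3) and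
  \<open>|F(x,\<cdot>)| \<le> C w(x)\<close> bound \<open>\<integral>|m|\<close> against the measure of \<open>x\<close> by a multiple of \<open>w(x)\<close>; so
  (PCLI3) can be integrated over \<open>\<nu>0\<close>, and the identity on half-open intervals extends to Borel sets.
\<close>

section \<open>Marginals of the Ionescu-Tulcea measure and integrals over mixtures\<close>

text \<open>Coordinate \<open>n\<close> is a function of the first \<open>Suc n\<close> coordinates,
  and on these the projective limit agrees with the finite-horizon law
  \<open>C 0 (Suc n)\<close>.\<close>

lemma (in Ionescu_Tulcea) distr_lim_component:
  "distr PF.lim (M n) (\<lambda>\<omega>. \<omega> n) = distr (C 0 (Suc n) (\<lambda>x. undefined)) (M n) (\<lambda>\<omega>. \<omega> n)"
proof -
  \<comment> \<open>\<open>CI\<close> is built from the shortest initial segment that covers the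
    index set; here the index set is itself an initial segment.\<close>
  have up: "up_to {0..<Suc n} = Suc n"
    by (intro antisym) (auto simp: up_to_iff not_less_eq_eq[symmetric] intro!: up_to_less)
  have u: "(\<lambda>x. undefined) \<in> space (PiM {0..<0} M)"
    by simp
  note s = sets_C[OF u, of "Suc n", unfolded add_0]
  have "distr PF.lim (M n) (\<lambda>\<omega>. \<omega> n) =
      distr (distr PF.lim (PiM {0..<Suc n} M) (\<lambda>x. restrict x {0..<Suc n})) (M n) (\<lambda>\<omega>. \<omega> n)"
    by (subst distr_distr)
       (auto simp: comp_def measurable_cong_sets[OF PF.sets_lim refl] intro!: measurable_restrict)
  also have "\<dots> = distr (C 0 (Suc n) (\<lambda>x. undefined)) (M n) (\<lambda>\<omega>. \<omega> n)"
    unfolding distr_lim[OF finite_atLeastLessThan] CI_def up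
    by (subst distr_distr)
       (auto simp: comp_def measurable_cong_sets[OF s refl] simp del: C.simps intro!: measurable_restrict)
  finally show ?thesis .
qed

text \<open>\<open>C 0 (Suc n)\<close> extends \<open>C 0 n\<close> by one draw from
  \<open>P n\<close>; projecting on the new coordinate keeps only that draw, averaged over the
  history.\<close>

lemma (in Ionescu_Tulcea) distr_lim_component_bind:
  "distr PF.lim (M n) (\<lambda>\<omega>. \<omega> n) = C 0 n (\<lambda>x. undefined) \<bind> P n"
proof -
  have u: "(\<lambda>x. undefined) \<in> space (PiM {0..<0} M)"
    by simp
  note s = sets_C[OF u, of n, unfolded add_0]
  have ne: "space (C 0 n (\<lambda>x. undefined)) \<noteq> {}"
    by (rule prob_space.not_empty[OF prob_space_C[OF u]])
  have "distr (C 0 n (\<lambda>x. undefined) \<bind> eP n) (M n) (\<lambda>\<omega>. \<omega> n) =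
      C 0 n (\<lambda>x. undefined) \<bind> (\<lambda>\<omega>. distr (eP n \<omega>) (M n) (\<lambda>\<omega>. \<omega> n))"
    by (rule distr_bind[OF _ ne, where K="PiM {0..<Suc n} M"])
       (simp_all add: measurable_cong_sets[OF s refl])
  also have "\<dots> = C 0 n (\<lambda>x. undefined) \<bind> P n"
  proof (rule bind_cong[OF refl])
    fix \<omega> assume "\<omega> \<in> space (C 0 n (\<lambda>x. undefined))"
    then have \<omega>: "\<omega> \<in> space (PiM {0..<n} M)"
      using space_C[OF u, of n] by simp
    have "fun_upd \<omega> n \<in> P n \<omega> \<rightarrow>\<^sub>M PiM {0..<Suc n} M"
      by (intro measurable_fun_upd[where J="{0..<n}"] measurable_const[OF \<omega>])
         (auto simp: measurable_cong_sets[OF sets_P[OF \<omega>] refl])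
    then have "distr (eP n \<omega>) (M n) (\<lambda>\<omega>. \<omega> n) = distr (P n \<omega>) (M n) (\<lambda>x. x)"
      unfolding eP_def by (subst distr_distr) (auto simp: comp_def)
    then show "distr (eP n \<omega>) (M n) (\<lambda>\<omega>. \<omega> n) = P n \<omega>"
      by (simp add: distr_id2 sets_P[OF \<omega>])
  qed
  finally show ?thesis
    by (simp add: distr_lim_component)
qed

text \<open>The Bochner version of \<open>nn_integral_bind\<close>. Finiteness of the iterated
  integral of \<open>\<bar>f y\<bar>\<close> makes \<open>f\<close> integrable under
  \<open>K x\<close> for almost every \<open>x\<close>; the nonnegative formula is then applied to
  the positive and the negative part.\<close>

lemma
  fixes f :: "'b \<Rightarrow> real"
  assumes K: "K \<in> M \<rightarrow>\<^sub>M subprob_algebra B" and ne: "space M \<noteq> {}"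
    and f: "f \<in> borel_measurable B"
    and fin: "(\<integral>\<^sup>+x. \<integral>\<^sup>+y. ennreal \<bar>f y\<bar> \<partial>K x \<partial>M) < \<infinity>"
  shows integrable_bind_kernel: "integrable (M \<bind> K) f"
    and integral_bind_kernel: "(\<integral>y. f y \<partial>(M \<bind> K)) = (\<integral>x. \<integral>y. f y \<partial>K x \<partial>M)"
proof -
  note [measurable] = K f
  have s: "sets (M \<bind> K) = sets B"
    by (rule sets_bind_measurable[OF K ne])
  have fb: "f \<in> borel_measurable (M \<bind> K)"
    by (simp add: measurable_cong_sets[OF s refl])
  show int: "integrable (M \<bind> K) f"
    using fin fb by (simp add: integrable_iff_bounded nn_integral_bind[OF _ K])
  have meas: "(\<lambda>x. \<integral>\<^sup>+y. ennreal (g y) \<partial>K x) \<in> borel_measurable M"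
    if [measurable]: "g \<in> borel_measurable B" for g :: "'b \<Rightarrow> real"
    by measurable
  have "AE x in M. (\<integral>\<^sup>+y. ennreal \<bar>f y\<bar> \<partial>K x) \<noteq> \<infinity>"
    using fin by (intro nn_integral_PInf_AE meas) auto
  then have AE: "AE x in M. integrable (K x) f"
    using AE_space
  proof eventually_elim
    case (elim x)
    then show ?case
      using f by (simp add: integrable_iff_bounded less_top measurable_cong_sets[OF sets_kernel[OF K] refl])
  qed
  \<comment> \<open>Since \<open>ennreal\<close> sends negative numbers to 0,
    \<open>ennreal (g y)\<close> is the positive part of \<open>g\<close>. The cases
    \<open>f\<close> and \<open>- f\<close> give the two parts of \<open>f\<close>.\<close>
  have part: "integrable M (\<lambda>x. enn2real (\<integral>\<^sup>+y. ennreal (g y) \<partial>K x)) \<and>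
     (\<integral>x. enn2real (\<integral>\<^sup>+y. ennreal (g y) \<partial>K x) \<partial>M) = enn2real (\<integral>\<^sup>+x. \<integral>\<^sup>+y. ennreal (g y) \<partial>K x \<partial>M)"
    if [measurable]: "g \<in> borel_measurable B" and le: "\<And>y. g y \<le> \<bar>f y\<bar>" for g :: "'b \<Rightarrow> real"
  proof -
    have lt: "(\<integral>\<^sup>+x. \<integral>\<^sup>+y. ennreal (g y) \<partial>K x \<partial>M) < \<infinity>"
      by (rule le_less_trans[OF _ fin]) (intro nn_integral_mono ennreal_leI le)
    then have "AE x in M. (\<integral>\<^sup>+y. ennreal (g y) \<partial>K x) \<noteq> \<infinity>"
      by (intro nn_integral_PInf_AE meas) auto
    then have eq: "(\<integral>\<^sup>+x. ennreal (enn2real (\<integral>\<^sup>+y. ennreal (g y) \<partial>K x)) \<partial>M) =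
        (\<integral>\<^sup>+x. \<integral>\<^sup>+y. ennreal (g y) \<partial>K x \<partial>M)"
      by (intro nn_integral_cong_AE) (auto simp: less_top)
    show ?thesis
      using lt eq by (auto simp: integrable_iff_bounded integral_eq_nn_integral)
  qed
  have "(\<integral>x. \<integral>y. f y \<partial>K x \<partial>M) = (\<integral>x. enn2real (\<integral>\<^sup>+y. ennreal (f y) \<partial>K x) -
      enn2real (\<integral>\<^sup>+y. ennreal (- f y) \<partial>K x) \<partial>M)"
    using AE by (intro integral_cong_AE) (auto simp: real_lebesgue_integral_def)
  also have "\<dots> = (\<integral>y. f y \<partial>(M \<bind> K))"
    using part[of f] part[of "\<lambda>y. - f y"]
    by (simp add: real_lebesgue_integral_def[OF int] nn_integral_bind[OF _ K])
  finally show "(\<integral>y. f y \<partial>(M \<bind> K)) = (\<integral>x. \<integral>y. f y \<partial>K x \<partial>M)" ..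
qed

lemma measurable_pair_discrete:
  assumes "\<And>a. f a \<in> X \<rightarrow>\<^sub>M Y"
  shows "(\<lambda>p. f (snd p) (fst p)) \<in> X \<Otimes>\<^sub>M count_space (UNIV :: 'a :: countable set) \<rightarrow>\<^sub>M Y"
proof -
  have "(\<lambda>(a, x). f a x) \<in> count_space UNIV \<Otimes>\<^sub>M X \<rightarrow>\<^sub>M Y"
    using assms by (intro measurable_pair_measure_countable1) auto
  from measurable_pair_swap[OF this] show ?thesis by (simp add: case_prod_beta')
qed

section \<open>Finite measures and signed measures on the line\<close>

lemma UN_Ioc_nat: "(\<Union>i::nat. {- real i<..real i}) = UNIV"
  by (rule UN_Ioc_eq_UNIV)

text \<open>Half-open intervals are an intersection-stable generator, and
  \<open>{- real i<..real i}\<close> exhausts the line by sets of finite measure. This yields the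
  uniqueness behind \<open>G_measure\<close>.\<close>

lemma measure_eqI_Ioc:
  fixes \<mu> \<nu> :: "real measure"
  assumes s: "sets \<mu> = sets borel" "sets \<nu> = sets borel"
    and fin: "\<And>a b. a < b \<Longrightarrow> emeasure \<mu> {a<..b} \<noteq> \<infinity>"
    and eq: "\<And>a b. a < b \<Longrightarrow> emeasure \<mu> {a<..b} = emeasure \<nu> {a<..b}"
  shows "\<mu> = \<nu>"
proof (rule measure_eqI_generator_eq[where E="range (\<lambda>(a, b). {a<..b})" and \<Omega>=UNIV
      and A="\<lambda>i::nat. {- real i<..real i}"])
  show "Int_stable (range (\<lambda>(a::real, b). {a<..b}))"
    by (auto simp: Int_stable_def)
  show "emeasure \<mu> X = emeasure \<nu> X" if "X \<in> range (\<lambda>(a, b). {a<..b})" for X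
  proof -
    from that obtain a b where "X = {a<..b}" by auto
    then show ?thesis using eq[of a b] by (cases "a < b") auto
  qed
  show "emeasure \<mu> {- real i<..real i} \<noteq> \<infinity>" for i
    using fin[of "- real i" "real i"] by (cases "0 < i") auto
qed (use s in \<open>auto simp: borel_sigma_sets_Ioc UN_Ioc_nat\<close>)

lemma finite_signed_measure_Un:
  assumes \<mu>: "finite_signed_measure M \<mu>" and A: "A \<in> sets M" "B \<in> sets M" "A \<inter> B = {}"
  shows "\<mu> (A \<union> B) = \<mu> A + \<mu> B"
proof -
  have "range (binaryset A B) \<subseteq> sets M" "disjoint_family (binaryset A B)"
    using A by (auto simp: range_binaryset_eq disjoint_family_on_def binaryset_def)
  then have "(\<lambda>i. \<mu> (binaryset A B i)) sums \<mu> (\<Union>i. binaryset A B i)"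
    using \<mu> by (simp add: finite_signed_measure_def)
  moreover have "(\<lambda>i. \<mu> (binaryset A B i)) sums (\<mu> A + \<mu> B)"
    using \<mu> by (intro binaryset_sums) (simp add: finite_signed_measure_def)
  ultimately show ?thesis
    by (metis sums_unique2 UN_binaryset_eq)
qed

text \<open>Dynkin's induction: agreement passes to countable disjoint unions by additivity, and to
  complements once the two total masses agree. This yields the uniqueness behind
  \<open>F_measure\<close>.\<close>

lemma finite_signed_measure_eqI_Ioc:
  assumes \<mu>: "finite_signed_measure borel \<mu>" and \<nu>: "finite_signed_measure borel \<nu>"
    and eq: "\<And>a b::real. a < b \<Longrightarrow> \<mu> {a<..b} = \<nu> {a<..b}"
  shows "\<mu> = \<nu>"
proof
  fix X :: "real set"
  let ?G = "range (\<lambda>(a::real, b). {a<..b})"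
  have emp: "\<mu> {} = 0" "\<nu> {} = 0"
    using \<mu> \<nu> by (auto simp: finite_signed_measure_def)
  have gen: "\<mu> A = \<nu> A" if "A \<in> ?G" for A
  proof -
    from that obtain a b where "A = {a<..b}" by auto
    then show ?thesis using eq[of a b] emp by (cases "a < b") auto
  qed
  have add: "\<lbrakk>range A \<subseteq> sets borel; disjoint_family A\<rbrakk> \<Longrightarrow> (\<lambda>i::nat. \<rho> (A i)) sums \<rho> (\<Union>i. A i)"
    if "finite_signed_measure borel \<rho>" for A and \<rho> :: "real set \<Rightarrow> real"
    using that by (simp add: finite_signed_measure_def)
  have UNIV: "\<mu> UNIV = \<nu> UNIV"
  proof -
    \<comment> \<open>The line is cut into unit intervals with integer end points, enumerated by
      \<open>int_decode\<close>; \<open>x\<close> lies in the one whose right end is its ceiling.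
      Additivity over them gives the total mass without any limit of growing intervals.\<close>
    let ?A = "\<lambda>n. {of_int (int_decode n) - 1<..of_int (int_decode n) :: real}"
    have A: "?A n = {x. \<lceil>x\<rceil> = int_decode n}" for n
      by (auto simp: ceiling_eq_iff)
    have "disjoint_family ?A"
      unfolding A by (auto simp: disjoint_family_on_def int_decode_eq)
    moreover have "range ?A \<subseteq> sets borel" by auto
    moreover have "(\<Union>n. ?A n) = UNIV"
      unfolding A by auto (metis int_encode_inverse)
    ultimately have "(\<lambda>n. \<mu> (?A n)) sums \<mu> UNIV" "(\<lambda>n. \<nu> (?A n)) sums \<nu> UNIV"
      using add[OF \<mu>, of ?A] add[OF \<nu>, of ?A] by simp_all
    moreover have "\<mu> (?A n) = \<nu> (?A n)" for n
      by (rule eq) simp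
    ultimately show ?thesis by (simp add: sums_unique2)
  qed
  have "\<mu> X = \<nu> X" if "X \<in> sigma_sets UNIV ?G"
  proof -
    have "Int_stable ?G" "?G \<subseteq> Pow UNIV"
      by (auto simp: Int_stable_def)
    from this that show ?thesis
    proof (induction rule: sigma_sets_induct_disjoint)
      case (compl A)
      then have A: "A \<in> sets borel" by (simp add: borel_sigma_sets_Ioc)
      have "\<mu> (A \<union> (UNIV - A)) = \<mu> A + \<mu> (UNIV - A)" "\<nu> (A \<union> (UNIV - A)) = \<nu> A + \<nu> (UNIV - A)"
        using A by (intro finite_signed_measure_Un[OF \<mu>] finite_signed_measure_Un[OF \<nu>]; auto)+
      then show ?case using compl UNIV by simp
    next
      case (union A)
      then have "range A \<subseteq> sets borel" by (simp add: borel_sigma_sets_Ioc)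
      then show ?case
        using add[OF \<mu> _ union(1)] add[OF \<nu> _ union(1)] union(3) by (simp add: sums_unique2)
    qed (use gen emp in auto)
  qed
  \<comment> \<open>Outside the Borel sets both functions are 0 by the convention in
    \<open>finite_signed_measure\<close>.\<close>
  then show "\<mu> X = \<nu> X"
    using \<mu> \<nu> by (cases "X \<in> sigma_sets UNIV ?G") (auto simp: borel_sigma_sets_Ioc finite_signed_measure_def)
qed

text \<open>Finite additivity handles the unions of the first \<open>n\<close> sets, and continuity
  of the integral along increasing sets handles the limit.\<close>

lemma finite_signed_measure_density:
  fixes f :: "'a \<Rightarrow> real"
  assumes f: "integrable M f"
  shows "finite_signed_measure M (\<lambda>S. if S \<in> sets M then LINT x:S|M. f x else 0)"
  unfolding finite_signed_measure_def
proof (intro conjI allI impI)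
  fix A :: "nat \<Rightarrow> 'a set" assume A: "range A \<subseteq> sets M" "disjoint_family A"
  then have sets: "A i \<in> sets M" for i by auto
  have int: "set_integrable M X f" if "X \<in> sets M" for X
    unfolding set_integrable_def using f that by (intro integrable_mult_indicator)
  have "(\<lambda>n. LINT x:(\<Union>i<n. A i)|M. f x) \<longlonglongrightarrow> (LINT x:(\<Union>n. \<Union>i<n. A i)|M. f x)"
    using sets by (intro set_integral_cont_up int) (auto simp: incseq_def intro: less_le_trans)
  also have "(\<lambda>n. LINT x:(\<Union>i<n. A i)|M. f x) = (\<lambda>n. \<Sum>i<n. LINT x:A i|M. f x)"
    using sets A(2) by (intro ext set_integral_finite_Union int) (auto simp: disjoint_family_on_def)
  also have "(\<Union>n. \<Union>i<n. A i) = (\<Union>i. A i)"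
    by auto
  finally have "(\<lambda>i. LINT x:A i|M. f x) sums (LINT x:(\<Union>i. A i)|M. f x)"
    by (simp add: sums_def)
  moreover have "(\<Union>i. A i) \<in> sets M" using sets by auto
  ultimately show "(\<lambda>i. if A i \<in> sets M then LINT x:A i|M. f x else 0) sums
      (if (\<Union>i. A i) \<in> sets M then LINT x:(\<Union>i. A i)|M. f x else 0)"
    using sets by simp
qed (auto simp: set_lebesgue_integral_def)

section \<open>Mixtures of Lebesgue-Stieltjes measures\<close>

text \<open>Each interval \<open>{- real i<..real i}\<close> has as its mass an increment of
  \<open>H\<close>, at most \<open>2 * V\<close>; the total mass is the supremum of these.\<close>

lemma emeasure_interval_measure_UNIV_le:
  assumes mono: "mono H" and rc: "\<And>a. continuous (at_right a) H" and bd: "\<And>z. \<bar>H z\<bar> \<le> V"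
  shows "emeasure (interval_measure H) UNIV \<le> ennreal (2 * V)"
proof -
  have "emeasure (interval_measure H) UNIV = (SUP i. emeasure (interval_measure H) {- real i<..real i})"
    unfolding UN_Ioc_nat[symmetric]
    by (rule SUP_emeasure_incseq[symmetric]) (auto simp: incseq_def)
  also have "\<dots> \<le> ennreal (2 * V)"
  proof (rule SUP_least)
    fix i :: nat
    have "H (real i) - H (- real i) \<le> 2 * V"
      using bd[of "real i"] bd[of "- real i"] by linarith
    then show "emeasure (interval_measure H) {- real i<..real i} \<le> ennreal (2 * V)"
      using mono rc by (subst emeasure_interval_measure_Ioc) (auto simp: monoD intro: ennreal_leI)
  qed
  finally show ?thesis .
qed

text \<open>
  The increments \<open>K b - K a\<close> control the integral of \<open>m\<close> only up to cancellation; since \<open>m\<close> is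
  monotone, \<open>m - m 0\<close> has constant sign on either side of \<open>0\<close> and no cancellation occurs.
\<close>
lemma nn_integral_monotone_density_le:
  fixes H K m :: "real \<Rightarrow> real"
  assumes mono: "mono H" and rc: "\<And>a. continuous (at_right a) H"
    and HV: "\<And>z. \<bar>H z\<bar> \<le> V" and KV: "\<And>z. \<bar>K z\<bar> \<le> V" and m: "mono m"
    and K: "\<And>a b. a < b \<Longrightarrow> K b - K a = (LINT z:{a<..b}|interval_measure H. m z)"
  shows "(\<integral>\<^sup>+z. ennreal \<bar>m z\<bar> \<partial>interval_measure H) \<le> ennreal ((4 + 6 * \<bar>m 0\<bar>) * V)"
proof -
  let ?\<mu> = "interval_measure H"
  have V: "0 \<le> V" using HV[of 0] by linarith
  have [measurable]: "m \<in> borel_measurable borel"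
    by (rule borel_measurable_mono[OF m])
  have lt: "emeasure ?\<mu> A < \<infinity>" for A
  proof -
    have "emeasure ?\<mu> A \<le> emeasure ?\<mu> (space ?\<mu>)"
      by (rule emeasure_space)
    also have "\<dots> \<le> ennreal (2 * V)"
      using emeasure_interval_measure_UNIV_le[OF mono rc HV] by simp
    also have "\<dots> < \<infinity>" by simp
    finally show ?thesis .
  qed
  have im: "set_integrable ?\<mu> {a<..b} m" for a b
    unfolding set_integrable_def
  proof (rule integrableI_bounded_set_indicator[where B="max \<bar>m a\<bar> \<bar>m b\<bar>"])
    show "AE z in ?\<mu>. z \<in> {a<..b} \<longrightarrow> norm (m z) \<le> max \<bar>m a\<bar> \<bar>m b\<bar>"
    proof (intro AE_I2 impI)
      fix z assume "z \<in> {a<..b}"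
      then have "m a \<le> m z" "m z \<le> m b" using m by (auto intro: monoD)
      then show "norm (m z) \<le> max \<bar>m a\<bar> \<bar>m b\<bar>" by auto
    qed
  qed (use lt in simp_all)
  have ic: "set_integrable ?\<mu> {a<..b} (\<lambda>_. c :: real)" for a b c
    unfolding set_integrable_def
    by (rule integrableI_bounded_set_indicator[where B="\<bar>c\<bar>"]) (use lt in simp_all)
  have c: "(LINT z:{a<..b}|?\<mu>. c) = c * (H b - H a)" if "a < b" for a b c
  proof -
    have "measure ?\<mu> {a<..b} = H b - H a"
      using that mono rc by (intro measure_interval_measure_Ioc) (auto dest: monoD)
    then show ?thesis by (simp add: set_lebesgue_integral_def)
  qed
  have main: "(\<integral>\<^sup>+z. ennreal \<bar>m z - m 0\<bar> * indicator {- real i<..real i} z \<partial>?\<mu>) \<le> ennreal ((4 + 4 * \<bar>m 0\<bar>) * V)" for i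
  proof (cases "i = 0")
    case False
    define b where "b = real i"
    have b: "0 < b" using False by (simp add: b_def)
    have eq: "\<bar>m z - m 0\<bar> * indicator {- b<..b} z =
        indicator {0<..b} z *\<^sub>R (m z - m 0) + indicator {-b<..0} z *\<^sub>R (m 0 - m z)" for z
      using b m by (auto simp: indicator_def abs_if dest: monoD[of m z 0] monoD[of m 0 z])
    have int: "integrable ?\<mu> (\<lambda>z. indicator {0<..b} z *\<^sub>R (m z - m 0))"
      "integrable ?\<mu> (\<lambda>z. indicator {-b<..0} z *\<^sub>R (m 0 - m z))"
      using set_integral_diff(1)[OF im ic] set_integral_diff(1)[OF ic im] by (auto simp: set_integrable_def)
    have "(\<integral>\<^sup>+z. ennreal \<bar>m z - m 0\<bar> * indicator {- b<..b} z \<partial>?\<mu>) =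
        (\<integral>\<^sup>+z. ennreal (\<bar>m z - m 0\<bar> * indicator {- b<..b} z) \<partial>?\<mu>)"
      by (intro nn_integral_cong) (simp add: indicator_def)
    also have "\<dots> = ennreal (\<integral>z. \<bar>m z - m 0\<bar> * indicator {- b<..b} z \<partial>?\<mu>)"
    proof (rule nn_integral_eq_integral)
      show "integrable ?\<mu> (\<lambda>z. \<bar>m z - m 0\<bar> * indicator {- b<..b} z)"
        unfolding eq by (rule Bochner_Integration.integrable_add[OF int])
    qed simp
    also have "(\<integral>z. \<bar>m z - m 0\<bar> * indicator {- b<..b} z \<partial>?\<mu>) =
        (LINT z:{0<..b}|?\<mu>. m z - m 0) + (LINT z:{-b<..0}|?\<mu>. m 0 - m z)"
      unfolding eq[abs_def] set_lebesgue_integral_def by (rule Bochner_Integration.integral_add[OF int])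
    also have "\<dots> = (K b - K 0 - m 0 * (H b - H 0)) + (m 0 * (H 0 - H (-b)) - (K 0 - K (-b)))"
      using b K[of 0 b] K[of "-b" 0] by (simp add: set_integral_diff(2)[OF im ic] set_integral_diff(2)[OF ic im] c)
    \<comment> \<open>The value \<open>K 0\<close> enters twice, so the \<open>K\<close> terms
      contribute at most \<open>4 * V\<close>; each of the two increments of \<open>H\<close>
      contributes at most \<open>\<bar>m 0\<bar> * (2 * V)\<close>.\<close>
    also have "\<dots> \<le> (4 + 4 * \<bar>m 0\<bar>) * V"
    proof -
      have "\<bar>m 0 * (H x - H y)\<bar> \<le> \<bar>m 0\<bar> * (2 * V)" for x y
        using HV[of x] HV[of y] by (auto simp: abs_mult intro!: mult_left_mono)
      from this[of b 0] this[of 0 "-b"] show ?thesis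
        using KV[of b] KV[of 0] KV[of "-b"] by (simp add: algebra_simps)
    qed
    finally show ?thesis by (simp add: b_def ennreal_leI)
  qed simp
  have "(\<integral>\<^sup>+z. ennreal \<bar>m z - m 0\<bar> \<partial>?\<mu>) =
      (\<integral>\<^sup>+z. (SUP i. ennreal \<bar>m z - m 0\<bar> * indicator {- real i<..real i} z) \<partial>?\<mu>)"
  proof (rule nn_integral_cong)
    fix z :: real
    obtain i :: nat where "\<bar>z\<bar> < real i" using reals_Archimedean2 by blast
    then have i: "z \<in> {- real i<..real i}" by auto
    show "ennreal \<bar>m z - m 0\<bar> = (SUP i. ennreal \<bar>m z - m 0\<bar> * indicator {- real i<..real i} z)"
    proof (rule antisym)
      show "ennreal \<bar>m z - m 0\<bar> \<le> (SUP i. ennreal \<bar>m z - m 0\<bar> * indicator {- real i<..real i} z)"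
        by (rule SUP_upper2[of i]) (use i in auto)
    qed (auto intro!: SUP_least split: split_indicator)
  qed
  also have "\<dots> = (SUP i. \<integral>\<^sup>+z. ennreal \<bar>m z - m 0\<bar> * indicator {- real i<..real i} z \<partial>?\<mu>)"
    by (rule nn_integral_monotone_convergence_SUP)
       (auto simp: incseq_def le_fun_def split: split_indicator)
  also have "\<dots> \<le> ennreal ((4 + 4 * \<bar>m 0\<bar>) * V)"
    by (rule SUP_least) (rule main)
  finally have A: "(\<integral>\<^sup>+z. ennreal \<bar>m z - m 0\<bar> \<partial>?\<mu>) \<le> ennreal ((4 + 4 * \<bar>m 0\<bar>) * V)" .
  \<comment> \<open>Undoing the shift by \<open>m 0\<close> costs \<open>\<bar>m 0\<bar>\<close>
    times the total mass, which is at most \<open>2 * V\<close>; this turns the coefficient 4 of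
    \<open>\<bar>m 0\<bar>\<close> into 6.\<close>
  have "(\<integral>\<^sup>+z. ennreal \<bar>m z\<bar> \<partial>?\<mu>) \<le> (\<integral>\<^sup>+z. ennreal \<bar>m z - m 0\<bar> + ennreal \<bar>m 0\<bar> \<partial>?\<mu>)"
    by (intro nn_integral_mono) (auto simp: ennreal_plus[symmetric] simp del: ennreal_plus intro!: ennreal_leI)
  also have "\<dots> = (\<integral>\<^sup>+z. ennreal \<bar>m z - m 0\<bar> \<partial>?\<mu>) + ennreal \<bar>m 0\<bar> * emeasure ?\<mu> UNIV"
    by (subst nn_integral_add) auto
  also have "\<dots> \<le> ennreal ((4 + 4 * \<bar>m 0\<bar>) * V) + ennreal \<bar>m 0\<bar> * ennreal (2 * V)"
    by (intro add_mono A mult_left_mono emeasure_interval_measure_UNIV_le[OF mono rc HV]) simp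
  also have "\<dots> = ennreal ((4 + 6 * \<bar>m 0\<bar>) * V)"
    using V by (simp add: ennreal_mult'[symmetric] ennreal_plus[symmetric] algebra_simps del: ennreal_plus)
  finally show ?thesis .
qed

text \<open>The common integrable bound \<open>V\<close> lets monotonicity and right-continuity in
  \<open>z\<close> pass from each \<open>H x\<close> to the average over \<nu>, the latter by
  dominated convergence along sequences from the right.\<close>

lemma
  fixes \<nu> :: "'a measure" and H :: "'a \<Rightarrow> real \<Rightarrow> real" and V :: "'a \<Rightarrow> real"
  assumes meas: "\<And>z. (\<lambda>x. H x z) \<in> borel_measurable \<nu>" and V: "integrable \<nu> V"
    and bd: "\<And>x z. x \<in> space \<nu> \<Longrightarrow> \<bar>H x z\<bar> \<le> V x"
  shows integrable_dominated_family: "integrable \<nu> (\<lambda>x. H x z)"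
    and mono_integral_family: "(\<And>x. x \<in> space \<nu> \<Longrightarrow> mono (H x)) \<Longrightarrow> mono (\<lambda>z. \<integral>x. H x z \<partial>\<nu>)"
    and right_continuous_integral_family:
      "(\<And>x a. x \<in> space \<nu> \<Longrightarrow> continuous (at_right a) (H x)) \<Longrightarrow>
        continuous (at_right a) (\<lambda>z. \<integral>x. H x z \<partial>\<nu>)"
    and integral_family_bound: "\<bar>\<integral>x. H x z \<partial>\<nu>\<bar> \<le> (\<integral>x. V x \<partial>\<nu>)"
proof -
  show int: "integrable \<nu> (\<lambda>x. H x z)" for z
    by (rule Bochner_Integration.integrable_bound[OF V meas])
       (rule AE_I2, unfold real_norm_def, rule order_trans[OF bd abs_ge_self])
  show "mono (\<lambda>z. \<integral>x. H x z \<partial>\<nu>)" if "\<And>x. x \<in> space \<nu> \<Longrightarrow> mono (H x)"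
    using that by (intro monoI integral_mono int) (auto dest: monoD)
  show "continuous (at_right a) (\<lambda>z. \<integral>x. H x z \<partial>\<nu>)"
    if rc: "\<And>x a. x \<in> space \<nu> \<Longrightarrow> continuous (at_right a) (H x)"
    unfolding continuous_within
  proof (rule tendsto_at_right_sequentially[of a "a + 1"])
    fix s :: "nat \<Rightarrow> real" assume s: "\<And>n. a < s n" "s \<longlonglongrightarrow> a"
    show "(\<lambda>n. \<integral>x. H x (s n) \<partial>\<nu>) \<longlonglongrightarrow> (\<integral>x. H x a \<partial>\<nu>)"
    proof (rule integral_dominated_convergence[where w=V])
      show "AE x in \<nu>. (\<lambda>n. H x (s n)) \<longlonglongrightarrow> H x a"
      proof (rule AE_I2)
        fix x assume "x \<in> space \<nu>"
        from rc[OF this, of a] have "(H x \<longlongrightarrow> H x a) (at_right a)"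
          by (simp add: continuous_within)
        moreover have "filterlim s (at_right a) sequentially"
          using s by (auto simp: filterlim_at less_imp_neq[OF s(1), symmetric])
        ultimately show "(\<lambda>n. H x (s n)) \<longlonglongrightarrow> H x a"
          by (rule filterlim_compose)
      qed
    qed (use meas V bd in \<open>auto intro!: AE_I2\<close>)
  qed simp
  have "\<bar>\<integral>x. H x z \<partial>\<nu>\<bar> \<le> (\<integral>x. \<bar>H x z\<bar> \<partial>\<nu>)"
    by (rule integral_abs_bound)
  also have "\<dots> \<le> (\<integral>x. V x \<partial>\<nu>)"
    by (intro integral_mono integrable_abs int V bd)
  finally show "\<bar>\<integral>x. H x z \<partial>\<nu>\<bar> \<le> (\<integral>x. V x \<partial>\<nu>)" .
qed

text \<open>
  The measures \<open>interval_measure (H x)\<close> are normalized by \<open>W = 2 V + 1\<close> to subprobabilities, so that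
  the Giry monad applies; the factor is returned through the density of \<open>\<nu>\<close>.
\<close>
lemma
  fixes \<nu> :: "'a measure" and H K :: "'a \<Rightarrow> real \<Rightarrow> real" and V :: "'a \<Rightarrow> real" and m :: "real \<Rightarrow> real"
  assumes ne: "space \<nu> \<noteq> {}"
    and meas: "\<And>z. (\<lambda>x. H x z) \<in> borel_measurable \<nu>" "\<And>z. (\<lambda>x. K x z) \<in> borel_measurable \<nu>"
    and V: "integrable \<nu> V"
    and HV: "\<And>x z. x \<in> space \<nu> \<Longrightarrow> \<bar>H x z\<bar> \<le> V x" and KV: "\<And>x z. x \<in> space \<nu> \<Longrightarrow> \<bar>K x z\<bar> \<le> V x"
    and mono: "\<And>x. x \<in> space \<nu> \<Longrightarrow> mono (H x)"
    and rc: "\<And>x a. x \<in> space \<nu> \<Longrightarrow> continuous (at_right a) (H x)"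
    and m: "mono m"
    and K: "\<And>x a b. x \<in> space \<nu> \<Longrightarrow> a < b \<Longrightarrow> K x b - K x a = (LINT z:{a<..b}|interval_measure (H x). m z)"
  shows integrable_mixture_density: "integrable (interval_measure (\<lambda>z. \<integral>x. H x z \<partial>\<nu>)) m"
    and integral_mixture_density: "a < b \<Longrightarrow> (\<integral>x. K x b \<partial>\<nu>) - (\<integral>x. K x a \<partial>\<nu>) =
      (LINT z:{a<..b}|interval_measure (\<lambda>z. \<integral>x. H x z \<partial>\<nu>). m z)"
proof -
  \<comment> \<open>The mass of \<open>interval_measure (H x)\<close> is at most
    \<open>2 * V x\<close>; the summand 1 keeps \<open>W x\<close> positive where
    \<open>V x = 0\<close>.\<close>
  define W where "W x = 2 * V x + 1" for x
  define \<kappa> where "\<kappa> x = density (interval_measure (H x)) (\<lambda>_. ennreal (1 / W x))" for x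
  define \<nu>' where "\<nu>' = density \<nu> (\<lambda>x. ennreal (W x))"
  let ?h = "\<lambda>z. \<integral>x. H x z \<partial>\<nu>"
  have Vm [measurable]: "V \<in> borel_measurable \<nu>" using V by auto
  have [measurable]: "W \<in> borel_measurable \<nu>" unfolding W_def by measurable
  have [measurable]: "m \<in> borel_measurable borel" by (rule borel_measurable_mono[OF m])
  note [measurable] = meas
  have V0: "0 \<le> V x" if "x \<in> space \<nu>" for x using HV[OF that, of 0] by linarith
  have W: "0 < W x" if "x \<in> space \<nu>" for x using V0[OF that] by (simp add: W_def)
  have \<kappa>_emeasure: "emeasure (\<kappa> x) A = ennreal (1 / W x) * emeasure (interval_measure (H x)) A"
    if "A \<in> sets borel" for x A
    using that unfolding \<kappa>_def by (subst emeasure_density_const) auto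
  \<comment> \<open>Kernel measurability is tested on half-open intervals, where it reduces to the
    increments of \<open>H\<close>, and on the whole line, which is their limit.\<close>
  have \<kappa>: "\<kappa> \<in> \<nu> \<rightarrow>\<^sub>M subprob_algebra borel"
  proof (rule measurable_subprob_algebra_generated[where \<Omega>=UNIV and G="range (\<lambda>(a::real, b). {a<..b})"])
    show "Int_stable (range (\<lambda>(a::real, b). {a<..b}))"
      by (auto simp: Int_stable_def)
    have Ioc: "emeasure (\<kappa> x) {a<..b} = ennreal (1 / W x) * ennreal (if a \<le> b then H x b - H x a else 0)"
      if "x \<in> space \<nu>" for x a b
      using monoD[OF mono[OF that]] rc[OF that]
      by (simp add: \<kappa>_emeasure emeasure_interval_measure_Ioc_eq)
    show meas_Ioc: "(\<lambda>x. emeasure (\<kappa> x) A) \<in> borel_measurable \<nu>" if "A \<in> range (\<lambda>(a, b). {a<..b})" for A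
    proof -
      from that obtain a b where A: "A = {a<..b}" by auto
      have "(\<lambda>x. ennreal (1 / W x) * ennreal (if a \<le> b then H x b - H x a else 0)) \<in> borel_measurable \<nu>"
        by measurable
      then show ?thesis
        unfolding A by (subst measurable_cong[OF Ioc])
    qed
    have "emeasure (\<kappa> x) UNIV = (SUP i. emeasure (\<kappa> x) {- real i<..real i})" for x
      unfolding UN_Ioc_nat[symmetric]
      by (rule SUP_emeasure_incseq[symmetric]) (auto simp: incseq_def \<kappa>_def)
    then show "(\<lambda>x. emeasure (\<kappa> x) UNIV) \<in> borel_measurable \<nu>"
      by (auto intro!: borel_measurable_SUP meas_Ioc)
    show "subprob_space (\<kappa> x)" if "x \<in> space \<nu>" for x
    proof
      have "emeasure (\<kappa> x) UNIV \<le> ennreal (1 / W x) * ennreal (2 * V x)"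
        by (subst \<kappa>_emeasure) (simp, intro mult_left_mono emeasure_interval_measure_UNIV_le mono[OF that] rc[OF that] HV[OF that], simp)
      also have "\<dots> = ennreal (2 * V x / W x)"
        using W[OF that] by (subst ennreal_mult'[symmetric]) auto
      also have "\<dots> \<le> 1"
        using W[OF that] V0[OF that] by (simp add: W_def)
      finally show "emeasure (\<kappa> x) (space (\<kappa> x)) \<le> 1" by (simp add: \<kappa>_def)
    qed (simp add: \<kappa>_def)
  qed (auto simp: \<kappa>_def borel_sigma_sets_Ioc)
  have \<kappa>': "\<kappa> \<in> \<nu>' \<rightarrow>\<^sub>M subprob_algebra borel" and ne': "space \<nu>' \<noteq> {}"
    using \<kappa> ne by (simp_all add: \<nu>'_def)
  have nn: "(\<integral>\<^sup>+x. \<integral>\<^sup>+z. f z \<partial>\<kappa> x \<partial>\<nu>') = (\<integral>\<^sup>+x. \<integral>\<^sup>+z. f z \<partial>interval_measure (H x) \<partial>\<nu>)"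
    if [measurable]: "f \<in> borel_measurable borel" for f
  proof -
    have "(\<lambda>x. \<integral>\<^sup>+z. f z \<partial>\<kappa> x) \<in> borel_measurable \<nu>"
      using measurable_compose[OF \<kappa> nn_integral_measurable_subprob_algebra, of f] by simp
    then have "(\<integral>\<^sup>+x. \<integral>\<^sup>+z. f z \<partial>\<kappa> x \<partial>\<nu>') = (\<integral>\<^sup>+x. ennreal (W x) * (\<integral>\<^sup>+z. f z \<partial>\<kappa> x) \<partial>\<nu>)"
      unfolding \<nu>'_def by (subst nn_integral_density) auto
    also have "\<dots> = (\<integral>\<^sup>+x. \<integral>\<^sup>+z. f z \<partial>interval_measure (H x) \<partial>\<nu>)"
    proof (rule nn_integral_cong)
      fix x assume x: "x \<in> space \<nu>"
      have "(\<integral>\<^sup>+z. f z \<partial>\<kappa> x) = ennreal (1 / W x) * (\<integral>\<^sup>+z. f z \<partial>interval_measure (H x))"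
        unfolding \<kappa>_def by (subst nn_integral_density) (auto simp: nn_integral_cmult)
      then show "ennreal (W x) * (\<integral>\<^sup>+z. f z \<partial>\<kappa> x) = (\<integral>\<^sup>+z. f z \<partial>interval_measure (H x))"
        using W[OF x] by (simp add: mult.assoc[symmetric] ennreal_mult'[symmetric])
    qed
    finally show ?thesis .
  qed
  have intH: "integrable \<nu> (\<lambda>x. H x z)" and intK: "integrable \<nu> (\<lambda>x. K x z)" for z
    by (rule integrable_dominated_family[OF meas(1) V HV] integrable_dominated_family[OF meas(2) V KV], assumption)+
  note fam = mono_integral_family[OF meas(1) V HV mono] right_continuous_integral_family[OF meas(1) V HV rc]
  \<comment> \<open>On \<open>{a<..b}\<close> both sides have as their mass the \<nu>-integral of
    \<open>H x b - H x a\<close>.\<close>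
  have mix: "\<nu>' \<bind> \<kappa> = interval_measure ?h"
  proof (rule measure_eqI_Ioc)
    show "sets (\<nu>' \<bind> \<kappa>) = sets borel"
      by (rule sets_bind_measurable[OF \<kappa>' ne'])
    show eq: "emeasure (\<nu>' \<bind> \<kappa>) {a<..b} = emeasure (interval_measure ?h) {a<..b}" if "a < b" for a b
    proof -
      have "emeasure (\<nu>' \<bind> \<kappa>) {a<..b} = (\<integral>\<^sup>+x. \<integral>\<^sup>+z. indicator {a<..b} z \<partial>\<kappa> x \<partial>\<nu>')"
        using emeasure_bind[OF ne' \<kappa>', of "{a<..b}"]
        by (auto intro!: nn_integral_cong simp: nn_integral_indicator \<kappa>_def)
      also have "\<dots> = (\<integral>\<^sup>+x. \<integral>\<^sup>+z. indicator {a<..b} z \<partial>interval_measure (H x) \<partial>\<nu>)"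
        by (rule nn) simp
      also have "\<dots> = (\<integral>\<^sup>+x. ennreal (H x b - H x a) \<partial>\<nu>)"
        using that mono rc by (intro nn_integral_cong) (auto simp: emeasure_interval_measure_Ioc monoD)
      also have "\<dots> = ennreal (\<integral>x. H x b - H x a \<partial>\<nu>)"
        using that monoD[OF mono] intH
        by (intro nn_integral_eq_integral AE_I2 Bochner_Integration.integrable_diff) auto
      also have "(\<integral>x. H x b - H x a \<partial>\<nu>) = ?h b - ?h a"
        using intH by simp
      also have "ennreal (?h b - ?h a) = emeasure (interval_measure ?h) {a<..b}"
        using that monoD[OF fam(1)] fam(2) by (simp add: emeasure_interval_measure_Ioc)
      finally show ?thesis .
    qed
    show "emeasure (\<nu>' \<bind> \<kappa>) {a<..b} \<noteq> \<infinity>" if "a < b" for a b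
      unfolding eq[OF that] using that monoD[OF fam(1)] fam(2) by (simp add: emeasure_interval_measure_Ioc)
  qed simp
  have "(\<integral>\<^sup>+x. \<integral>\<^sup>+z. ennreal \<bar>m z\<bar> \<partial>\<kappa> x \<partial>\<nu>') = (\<integral>\<^sup>+x. \<integral>\<^sup>+z. ennreal \<bar>m z\<bar> \<partial>interval_measure (H x) \<partial>\<nu>)"
    by (rule nn) simp
  \<comment> \<open>The bound for each \<open>x\<close> is linear in \<open>V x\<close>, hence
    integrable over \<nu>; this is what makes \<open>m\<close> integrable against the mixture
    although \<open>m\<close> may be unbounded.\<close>
  also have "\<dots> \<le> (\<integral>\<^sup>+x. ennreal ((4 + 6 * \<bar>m 0\<bar>) * V x) \<partial>\<nu>)"
  proof (rule nn_integral_mono)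
    fix x assume x: "x \<in> space \<nu>"
    show "(\<integral>\<^sup>+z. ennreal \<bar>m z\<bar> \<partial>interval_measure (H x)) \<le> ennreal ((4 + 6 * \<bar>m 0\<bar>) * V x)"
      by (rule nn_integral_monotone_density_le[OF mono[OF x] rc[OF x] HV[OF x] KV[OF x] m K[OF x]])
  qed
  also have "\<dots> = ennreal (\<integral>x. (4 + 6 * \<bar>m 0\<bar>) * V x \<partial>\<nu>)"
    using V V0 by (intro nn_integral_eq_integral AE_I2) auto
  also have "\<dots> < \<infinity>" by simp
  finally have fin: "(\<integral>\<^sup>+x. \<integral>\<^sup>+z. ennreal \<bar>m z\<bar> \<partial>\<kappa> x \<partial>\<nu>') < \<infinity>" .
  show "integrable (interval_measure ?h) m"
    unfolding mix[symmetric] using fin by (intro integrable_bind_kernel[OF \<kappa>' ne']) simp_all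
  assume ab: "a < b"
  let ?m = "\<lambda>z. indicator {a<..b} z *\<^sub>R m z"
  have "(\<integral>\<^sup>+x. \<integral>\<^sup>+z. ennreal \<bar>?m z\<bar> \<partial>\<kappa> x \<partial>\<nu>') < \<infinity>"
    by (rule le_less_trans[OF _ fin]) (intro nn_integral_mono ennreal_leI, simp split: split_indicator)
  then have "(LINT z:{a<..b}|interval_measure ?h. m z) = (\<integral>x. \<integral>z. ?m z \<partial>\<kappa> x \<partial>\<nu>')"
    unfolding mix[symmetric] set_lebesgue_integral_def by (intro integral_bind_kernel[OF \<kappa>' ne']) simp_all
  also have "\<dots> = (\<integral>x. W x *\<^sub>R (\<integral>z. ?m z \<partial>\<kappa> x) \<partial>\<nu>)"
    unfolding \<nu>'_def
    using measurable_compose[OF \<kappa> integral_measurable_subprob_algebra, of ?m] W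
    by (intro integral_density) (auto intro!: AE_I2 less_imp_le)
  also have "\<dots> = (\<integral>x. K x b - K x a \<partial>\<nu>)"
  proof (rule Bochner_Integration.integral_cong[OF refl])
    fix x assume x: "x \<in> space \<nu>"
    have "(\<integral>z. ?m z \<partial>\<kappa> x) = (\<integral>z. (1 / W x) *\<^sub>R ?m z \<partial>interval_measure (H x))"
      unfolding \<kappa>_def using W[OF x] by (intro integral_density) auto
    also have "\<dots> = (1 / W x) * (K x b - K x a)"
      unfolding K[OF x ab] set_lebesgue_integral_def by simp
    finally show "W x *\<^sub>R (\<integral>z. ?m z \<partial>\<kappa> x) = K x b - K x a"
      using W[OF x] by simp
  qed
  also have "\<dots> = (\<integral>x. K x b \<partial>\<nu>) - (\<integral>x. K x a \<partial>\<nu>)"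
    using intK by simp
  finally show "(\<integral>x. K x b \<partial>\<nu>) - (\<integral>x. K x a \<partial>\<nu>) = (LINT z:{a<..b}|interval_measure ?h. m z)" ..
qed

section \<open>The discounted transition operator\<close>

locale project_model =
  fixes P :: project and w :: "real \<Rightarrow> real" and M \<gamma> :: real
  assumes standing: "standing_assumption P w M \<gamma>"
begin

abbreviation "S \<equiv> states P"
abbreviation "N \<equiv> state_space P"
abbreviation "\<beta> \<equiv> discount P"

lemma space_N [simp]: "space N = S"
  by (simp add: state_space_def space_restrict_space)

lemma discount_nonneg: "0 \<le> \<beta>" and gamma: "0 \<le> \<gamma>" "\<gamma> < 1"
  using standing by (auto simp: standing_assumption_def)

lemma weight_measurable [measurable]: "w \<in> borel_measurable N"
  using standing by (auto simp: standing_assumption_def)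

lemma weight_ge_1: "x \<in> S \<Longrightarrow> 1 \<le> w x"
  using standing by (auto simp: standing_assumption_def)

lemma transition_measurable: "transition P a \<in> N \<rightarrow>\<^sub>M prob_algebra N"
  using standing by (auto simp: standing_assumption_def)

lemma transition_subprob [measurable]: "transition P a \<in> N \<rightarrow>\<^sub>M subprob_algebra N"
  by (rule measurable_prob_algebraD[OF transition_measurable])

lemma
  assumes "x \<in> S"
  shows sets_transition: "sets (transition P a x) = sets N"
    and space_transition: "space (transition P a x) = S"
  using measurable_space[OF transition_measurable[of a], of x] assms
  by (auto simp: space_prob_algebra dest: sets_eq_imp_space_eq)

lemma nn_integral_weight:
  "x \<in> S \<Longrightarrow> ennreal \<beta> * (\<integral>\<^sup>+y. ennreal (w y) \<partial>transition P a x) \<le> ennreal (\<gamma> * w x)"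
  using standing by (auto simp: standing_assumption_def)

text \<open>For positive \<beta> the drift inequality makes the integral of \<open>w\<close> under
  the kernel finite, and a multiple of \<open>w\<close> dominates \<phi>.\<close>

lemma integrable_transition:
  assumes x: "x \<in> S" and \<beta>: "0 < \<beta>" and [measurable]: "\<phi> \<in> borel_measurable N"
    and le: "\<And>y. y \<in> S \<Longrightarrow> \<bar>\<phi> y\<bar> \<le> C * w y"
  shows "integrable (transition P a x) \<phi>"
proof (rule Bochner_Integration.integrable_bound)
  note s = sets_transition[OF x, of a]
  have "(\<integral>\<^sup>+y. ennreal (w y) \<partial>transition P a x) < \<infinity>"
    using nn_integral_weight[OF x, of a] \<beta>
    by (auto simp: ennreal_mult_less_top less_top[symmetric] top_unique ennreal_mult_top)
  moreover have "(\<integral>\<^sup>+y. ennreal \<bar>w y\<bar> \<partial>transition P a x) = (\<integral>\<^sup>+y. ennreal (w y) \<partial>transition P a x)"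
    using weight_ge_1 by (intro nn_integral_cong) (force simp: space_transition[OF x])
  ultimately show "integrable (transition P a x) (\<lambda>y. C * w y)"
    by (intro integrable_mult_right) (simp add: integrable_iff_bounded measurable_cong_sets[OF s refl])
  show "\<phi> \<in> borel_measurable (transition P a x)"
    by (simp add: measurable_cong_sets[OF s refl])
  show "AE y in transition P a x. norm (\<phi> y) \<le> norm (C * w y)"
    using le by (intro AE_I2) (force simp: space_transition[OF x])
qed

text \<open>
  If \<open>\<beta> = 0\<close>, the standing assumption does not make \<open>w\<close> integrable under the transition kernel; the
  integral may then be the junk value \<open>0\<close>, but the factor \<open>\<beta>\<close> makes it irrelevant.
\<close>
definition step :: "bool \<Rightarrow> (real \<Rightarrow> real) \<Rightarrow> real \<Rightarrow> real" where
  "step a \<phi> x = \<beta> * (\<integral>y. \<phi> y \<partial>transition P a x)"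

lemma step_measurable [measurable (raw)]:
  "\<phi> \<in> borel_measurable N \<Longrightarrow> step a \<phi> \<in> borel_measurable N"
  unfolding step_def[abs_def]
  using measurable_compose[OF transition_subprob integral_measurable_subprob_algebra, of \<phi> a] by simp

lemma step_add:
  assumes "x \<in> S" "\<phi> \<in> borel_measurable N" "\<psi> \<in> borel_measurable N"
    "\<And>y. y \<in> S \<Longrightarrow> \<bar>\<phi> y\<bar> \<le> C * w y" "\<And>y. y \<in> S \<Longrightarrow> \<bar>\<psi> y\<bar> \<le> D * w y"
  shows "step a (\<lambda>y. \<phi> y + \<psi> y) x = step a \<phi> x + step a \<psi> x"
proof (cases "\<beta> = 0")
  case False
  then have \<beta>: "0 < \<beta>" using discount_nonneg by simp
  have int: "integrable (transition P a x) \<phi>" "integrable (transition P a x) \<psi>"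
    by (rule integrable_transition[OF assms(1) \<beta> assms(2)] integrable_transition[OF assms(1) \<beta> assms(3)],
        rule assms, assumption)+
  show ?thesis
    unfolding step_def Bochner_Integration.integral_add[OF int] by (rule distrib_left)
qed (simp add: step_def)

lemma step_minus: "step a (\<lambda>y. - \<phi> y) x = - step a \<phi> x"
  by (simp add: step_def)

lemma step_diff:
  assumes "x \<in> S" "\<phi> \<in> borel_measurable N" "\<psi> \<in> borel_measurable N"
    "\<And>y. y \<in> S \<Longrightarrow> \<bar>\<phi> y\<bar> \<le> C * w y" "\<And>y. y \<in> S \<Longrightarrow> \<bar>\<psi> y\<bar> \<le> D * w y"
  shows "step a (\<lambda>y. \<phi> y - \<psi> y) x = step a \<phi> x - step a \<psi> x"
  using step_add[of x \<phi> "\<lambda>y. - \<psi> y" C D a] assms by (simp add: step_minus)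

lemma step_mono:
  assumes "x \<in> S" "\<phi> \<in> borel_measurable N" "\<psi> \<in> borel_measurable N"
    "\<And>y. y \<in> S \<Longrightarrow> \<bar>\<phi> y\<bar> \<le> C * w y" "\<And>y. y \<in> S \<Longrightarrow> \<bar>\<psi> y\<bar> \<le> D * w y"
    and le: "\<And>y. y \<in> S \<Longrightarrow> \<phi> y \<le> \<psi> y"
  shows "step a \<phi> x \<le> step a \<psi> x"
proof (cases "\<beta> = 0")
  case False
  then have \<beta>: "0 < \<beta>" using discount_nonneg by simp
  have int: "integrable (transition P a x) \<phi>" "integrable (transition P a x) \<psi>"
    by (rule integrable_transition[OF assms(1) \<beta> assms(2)] integrable_transition[OF assms(1) \<beta> assms(3)],
        rule assms, assumption)+
  show ?thesis
    unfolding step_def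
    by (intro mult_left_mono[OF integral_mono[OF int]] discount_nonneg)
       (simp add: space_transition[OF assms(1)] le)
qed (simp add: step_def)

text \<open>The drift inequality of the standing assumption, transferred from nonnegative to Bochner
  integrals.\<close>

lemma step_weight:
  assumes "x \<in> S"
  shows "step a w x \<le> \<gamma> * w x"
proof (cases "\<beta> = 0")
  case False
  then have \<beta>: "0 < \<beta>" using discount_nonneg by simp
  have nn: "AE y in transition P a x. 0 \<le> w y"
    using weight_ge_1 assms by (intro AE_I2) (force simp: space_transition)
  have "integrable (transition P a x) w"
    using weight_ge_1 by (intro integrable_transition[OF assms \<beta> weight_measurable, of 1]) force
  then have "ennreal (step a w x) = ennreal \<beta> * (\<integral>\<^sup>+y. ennreal (w y) \<partial>transition P a x)"
    unfolding step_def using nn \<beta> by (simp add: nn_integral_eq_integral ennreal_mult integral_nonneg_AE)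
  also have "\<dots> \<le> ennreal (\<gamma> * w x)"
    by (rule nn_integral_weight[OF assms])
  finally show ?thesis
    using weight_ge_1[OF assms] gamma by (subst (asm) ennreal_le_iff) auto
qed (use weight_ge_1[OF assms] gamma in \<open>simp add: step_def\<close>)

lemma step_scaled_weight: "step a (\<lambda>y. C * w y) x = C * step a w x"
  by (simp add: step_def)

text \<open>Contraction in the weighted supremum norm: compare both \<phi> and its negative with
  \<open>C * w y\<close>, then use the drift inequality.\<close>

lemma step_bound:
  assumes x: "x \<in> S" and \<phi>: "\<phi> \<in> borel_measurable N" "\<And>y. y \<in> S \<Longrightarrow> \<bar>\<phi> y\<bar> \<le> C * w y"
  shows "\<bar>step a \<phi> x\<bar> \<le> \<gamma> * C * w x"
proof -
  have C: "0 \<le> C"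
    using \<phi>(2)[OF x] weight_ge_1[OF x] by (smt (verit) mult_neg_pos)
  have Cw: "\<bar>C * w y\<bar> \<le> C * w y" if "y \<in> S" for y
    using C weight_ge_1[OF that] by simp
  have m: "(\<lambda>y. C * w y) \<in> borel_measurable N" by simp
  have "step a \<phi> x \<le> step a (\<lambda>y. C * w y) x"
    using \<phi>(2) by (intro step_mono[OF x \<phi>(1) m \<phi>(2) Cw]) force+
  moreover have "step a (\<lambda>y. - \<phi> y) x \<le> step a (\<lambda>y. C * w y) x"
    using \<phi> by (intro step_mono[OF x _ m _ Cw, where C=C]) force+
  moreover have "C * step a w x \<le> C * (\<gamma> * w x)"
    using C step_weight[OF x] by (rule mult_left_mono[rotated])
  ultimately show ?thesis
    by (auto simp: step_scaled_weight step_minus mult_ac)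
qed

text \<open>Dominated convergence with \<open>C * w y\<close> as the dominating function.\<close>

lemma step_tendsto:
  assumes x: "x \<in> S" and \<phi>: "\<And>n. \<phi> n \<in> borel_measurable N" "\<psi> \<in> borel_measurable N"
    and le: "\<And>n y. y \<in> S \<Longrightarrow> \<bar>\<phi> n y\<bar> \<le> C * w y"
    and lim: "\<And>y. y \<in> S \<Longrightarrow> (\<lambda>n. \<phi> n y) \<longlonglongrightarrow> \<psi> y"
  shows "(\<lambda>n. step a (\<phi> n) x) \<longlonglongrightarrow> step a \<psi> x"
proof (cases "\<beta> = 0")
  case False
  then have \<beta>: "0 < \<beta>" using discount_nonneg by simp
  note s = sets_transition[OF x, of a]
  have "(\<lambda>n. \<integral>y. \<phi> n y \<partial>transition P a x) \<longlonglongrightarrow> (\<integral>y. \<psi> y \<partial>transition P a x)"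
  proof (rule integral_dominated_convergence)
    have "0 \<le> C * w y" if "y \<in> S" for y
      using le[OF that] by (rule order_trans[OF abs_ge_zero])
    then show "integrable (transition P a x) (\<lambda>y. C * w y)"
      by (intro integrable_transition[OF x \<beta>, of _ C]) auto
  qed (use \<phi> le lim in \<open>auto simp: measurable_cong_sets[OF s refl] space_transition[OF x] intro!: AE_I2\<close>)
  then show ?thesis
    unfolding step_def by (intro tendsto_intros)
qed (simp add: step_def)

section \<open>Iterating the transition operator under a threshold policy, and the resulting value
  function\<close>

definition weight_bounded :: "real \<Rightarrow> (real \<Rightarrow> bool \<Rightarrow> real) \<Rightarrow> bool" where
  "weight_bounded C f \<longleftrightarrow>
     (\<forall>a. (\<lambda>x. f x a) \<in> borel_measurable N) \<and> (\<forall>x\<in>S. \<forall>a. \<bar>f x a\<bar> \<le> C * w x)"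

definition closed_loop :: "ereal \<Rightarrow> (real \<Rightarrow> bool \<Rightarrow> real) \<Rightarrow> real \<Rightarrow> real" where
  "closed_loop z f x = f x (z < ereal x)"

lemma weight_boundedD:
  assumes "weight_bounded C f"
  shows "(\<lambda>x. f x a) \<in> borel_measurable N" "x \<in> S \<Longrightarrow> \<bar>f x a\<bar> \<le> C * w x"
  using assms by (auto simp: weight_bounded_def)

lemma weight_bounded_nonneg:
  assumes "weight_bounded C f" "x \<in> S"
  shows "0 \<le> C"
proof -
  have "0 \<le> C * w x"
    using weight_boundedD(2)[OF assms, of True] by (rule order_trans[OF abs_ge_zero])
  then show ?thesis
    using weight_ge_1[OF assms(2)] by (simp add: zero_le_mult_iff)
qed

lemma pred_threshold [measurable]: "Measurable.pred N (\<lambda>x. z < ereal x)"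
  unfolding state_space_def by (intro measurable_restrict_space1) measurable

lemma decision_measurable:
  assumes "\<And>a. (\<lambda>x. f x a) \<in> borel_measurable N" and [measurable]: "Measurable.pred N d"
  shows "(\<lambda>x. f x (d x)) \<in> borel_measurable N"
proof -
  note [measurable] = assms(1)
  have "(\<lambda>x. if d x then f x True else f x False) \<in> borel_measurable N"
    by measurable
  also have "(\<lambda>x. if d x then f x True else f x False) = (\<lambda>x. f x (d x))"
    by auto
  finally show ?thesis .
qed

lemma closed_loop_measurable: "weight_bounded C f \<Longrightarrow> closed_loop z f \<in> borel_measurable N"
  unfolding closed_loop_def[abs_def] by (rule decision_measurable[OF weight_boundedD(1) pred_threshold])

lemma closed_loop_bound: "weight_bounded C f \<Longrightarrow> x \<in> S \<Longrightarrow> \<bar>closed_loop z f x\<bar> \<le> C * w x"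
  unfolding closed_loop_def by (rule weight_boundedD(2))

text \<open>The discounted transition operator of the state-action chain: the current action
  \<open>a\<close> is arbitrary, all later ones are set by the threshold \<open>z\<close>.\<close>

definition lookahead :: "ereal \<Rightarrow> (real \<Rightarrow> bool \<Rightarrow> real) \<Rightarrow> real \<Rightarrow> bool \<Rightarrow> real" where
  "lookahead z f x a = step a (closed_loop z f) x"

lemma weight_bounded_lookahead:
  assumes "weight_bounded C f"
  shows "weight_bounded (\<gamma> * C) (lookahead z f)"
  unfolding weight_bounded_def lookahead_def
  by (intro conjI allI ballI step_measurable step_bound closed_loop_measurable[OF assms]
      closed_loop_bound[OF assms])

lemma weight_bounded_iter:
  "weight_bounded C f \<Longrightarrow> weight_bounded (C * \<gamma> ^ t) ((lookahead z ^^ t) f)"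
proof (induction t)
  case (Suc t)
  from weight_bounded_lookahead[OF Suc.IH[OF Suc.prems]] show ?case
    by (simp add: mult_ac)
qed simp

lemma iter_summable:
  assumes "weight_bounded C f" "x \<in> S"
  shows "summable (\<lambda>t. \<bar>(lookahead z ^^ t) f x a\<bar>)"
proof (rule summable_comparison_test')
  show "summable (\<lambda>t. C * w x * \<gamma> ^ t)"
    using gamma by (intro summable_mult summable_geometric) simp
  show "norm \<bar>(lookahead z ^^ t) f x a\<bar> \<le> C * w x * \<gamma> ^ t" for t
    using weight_boundedD(2)[OF weight_bounded_iter[OF assms(1)] assms(2)] by (simp add: mult_ac)
qed

text \<open>
  For \<open>f = reward P\<close> this is \<open>F(x,\<langle>a,z\<rangle>)\<close> of the paper, for \<open>f = resource P\<close> it is \<open>G(x,\<langle>a,z\<rangle>)\<close>.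
\<close>
definition q_value :: "ereal \<Rightarrow> (real \<Rightarrow> bool \<Rightarrow> real) \<Rightarrow> real \<Rightarrow> bool \<Rightarrow> real" where
  "q_value z f x a = (\<Sum>t. (lookahead z ^^ t) f x a)"

text \<open>A geometric series. The bound is uniform in \<open>n\<close>, so it survives in the
  limit \<open>q_value\<close> and also dominates the partial sums when the limit is taken under
  \<open>step\<close>.\<close>

lemma partial_sum_bound:
  assumes "weight_bounded C f" "x \<in> S"
  shows "\<bar>\<Sum>t<n. (lookahead z ^^ t) f x a\<bar> \<le> C / (1 - \<gamma>) * w x"
proof -
  have Cw: "0 \<le> C * w x"
    using weight_boundedD(2)[OF assms, of True] by (rule order_trans[OF abs_ge_zero])
  have "\<bar>\<Sum>t<n. (lookahead z ^^ t) f x a\<bar> \<le> (\<Sum>t<n. C * w x * \<gamma> ^ t)"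
    using weight_boundedD(2)[OF weight_bounded_iter[OF assms(1)] assms(2)]
    by (intro order_trans[OF sum_abs] sum_mono) (simp add: mult_ac)
  also have "\<dots> = C * w x * (\<Sum>t<n. \<gamma> ^ t)"
    by (simp add: sum_distrib_left)
  also have "\<dots> \<le> C * w x * (\<Sum>t. \<gamma> ^ t)"
    using gamma by (intro mult_left_mono[OF sum_le_suminf Cw]) (auto intro: summable_geometric)
  also have "\<dots> = C / (1 - \<gamma>) * w x"
    using gamma by (simp add: suminf_geometric)
  finally show ?thesis .
qed

lemma q_value_LIMSEQ:
  "weight_bounded C f \<Longrightarrow> x \<in> S \<Longrightarrow> (\<lambda>n. \<Sum>t<n. (lookahead z ^^ t) f x a) \<longlonglongrightarrow> q_value z f x a"
  unfolding q_value_def by (rule summable_LIMSEQ[OF summable_rabs_cancel[OF iter_summable]])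

lemma weight_bounded_q_value:
  assumes "weight_bounded C f"
  shows "weight_bounded (C / (1 - \<gamma>)) (q_value z f)"
  unfolding weight_bounded_def
proof (intro conjI allI ballI)
  show "(\<lambda>x. q_value z f x a) \<in> borel_measurable N" for a
    unfolding q_value_def
    by (intro borel_measurable_suminf weight_boundedD(1)[OF weight_bounded_iter[OF assms]])
  show "\<bar>q_value z f x a\<bar> \<le> C / (1 - \<gamma>) * w x" if "x \<in> S" for x a
    by (rule LIMSEQ_le_const2[OF tendsto_rabs[OF q_value_LIMSEQ[OF assms that]]])
       (use partial_sum_bound[OF assms that] in blast)
qed

lemma weight_bounded_sum:
  assumes "weight_bounded C f"
  shows "weight_bounded (C / (1 - \<gamma>)) (\<lambda>x a. \<Sum>t<n. (lookahead z ^^ t) f x a)"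
  unfolding weight_bounded_def
proof (intro conjI allI ballI)
  show "(\<lambda>x. \<Sum>t<n. (lookahead z ^^ t) f x a) \<in> borel_measurable N" for a
    by (rule borel_measurable_sum) (rule weight_boundedD(1)[OF weight_bounded_iter[OF assms]])
qed (rule partial_sum_bound[OF assms])

lemma lookahead_sum:
  assumes f: "weight_bounded C f" and x: "x \<in> S"
  shows "lookahead z (\<lambda>x a. \<Sum>t<n. (lookahead z ^^ t) f x a) x a = (\<Sum>t<n. (lookahead z ^^ Suc t) f x a)"
proof (induction n)
  case 0
  then show ?case by (simp add: lookahead_def closed_loop_def[abs_def] step_def)
next
  case (Suc n)
  have "lookahead z (\<lambda>x a. \<Sum>t<Suc n. (lookahead z ^^ t) f x a) x a =
      step a (\<lambda>y. closed_loop z (\<lambda>x a. \<Sum>t<n. (lookahead z ^^ t) f x a) y +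
                  closed_loop z ((lookahead z ^^ n) f) y) x"
    by (simp add: lookahead_def closed_loop_def[abs_def])
  also have "\<dots> = lookahead z (\<lambda>x a. \<Sum>t<n. (lookahead z ^^ t) f x a) x a + (lookahead z ^^ Suc n) f x a"
    using closed_loop_measurable[OF weight_bounded_sum[OF f]] closed_loop_measurable[OF weight_bounded_iter[OF f]]
      closed_loop_bound[OF weight_bounded_sum[OF f]] closed_loop_bound[OF weight_bounded_iter[OF f]]
    by (subst step_add[OF x, where C="C / (1 - \<gamma>)" and D="C * \<gamma> ^ n"]) (auto simp: lookahead_def)
  finally show ?case using Suc by simp
qed

text \<open>The policy evaluation equation: \<open>lookahead\<close> shifts the partial sums of the
  series by one term, and dominated convergence passes to the limit.\<close>

lemma q_value_eq:
  assumes f: "weight_bounded C f" and x: "x \<in> S"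
  shows "q_value z f x a = f x a + lookahead z (q_value z f) x a"
proof -
  have "(\<lambda>n. step a (closed_loop z (\<lambda>x a. \<Sum>t<n. (lookahead z ^^ t) f x a)) x) \<longlonglongrightarrow>
      step a (closed_loop z (q_value z f)) x"
  proof (rule step_tendsto[OF x])
    show "(\<lambda>n. closed_loop z (\<lambda>x a. \<Sum>t<n. (lookahead z ^^ t) f x a) y) \<longlonglongrightarrow> closed_loop z (q_value z f) y"
      if "y \<in> S" for y
      unfolding closed_loop_def by (rule q_value_LIMSEQ[OF f that])
  qed (rule closed_loop_measurable[OF weight_bounded_sum[OF f]]
        closed_loop_measurable[OF weight_bounded_q_value[OF f]] closed_loop_bound[OF weight_bounded_sum[OF f]],
        assumption?)+
  then have "(\<lambda>n. f x a + (\<Sum>t<n. (lookahead z ^^ Suc t) f x a)) \<longlonglongrightarrow> f x a + lookahead z (q_value z f) x a"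
    unfolding lookahead_def[symmetric] lookahead_sum[OF f x] by (intro tendsto_intros)
  moreover have "f x a + (\<Sum>t<n. (lookahead z ^^ Suc t) f x a) = (\<Sum>t<Suc n. (lookahead z ^^ t) f x a)" for n
    by (subst sum.lessThan_Suc_shift) simp
  ultimately have "(\<lambda>n. \<Sum>t<Suc n. (lookahead z ^^ t) f x a) \<longlonglongrightarrow> f x a + lookahead z (q_value z f) x a"
    by simp
  then show ?thesis
    using LIMSEQ_Suc[OF q_value_LIMSEQ[OF f x]] LIMSEQ_unique by blast
qed

section \<open>Reduction of the metrics to the discounted operator\<close>

lemma space_pair: "space (pair_space P) = S \<times> UNIV"
  by (simp add: pair_space_def space_pair_measure)

lemma act_measurable:
  assumes [measurable]: "Measurable.pred N d"
  shows "(\<lambda>x. (x, d x)) \<in> N \<rightarrow>\<^sub>M pair_space P"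
  unfolding pair_space_def by measurable

lemma fst_pair_measurable [measurable]: "fst \<in> pair_space P \<rightarrow>\<^sub>M N"
  by (simp add: pair_space_def)

lemma action_step_return_pmf:
  assumes "x \<in> S"
  shows "action_step P (\<lambda>x. return_pmf (d x)) x = return (pair_space P) (x, d x)"
proof -
  have "(\<lambda>a. (x, a)) \<in> count_space UNIV \<rightarrow>\<^sub>M pair_space P"
    using assms by (simp add: space_pair)
  then show ?thesis
    unfolding action_step_def return_pmf.rep_eq by (rule distr_return) simp
qed

lemma states_nonempty: "S \<noteq> {}"
proof -
  have "lower P < upper P"
    using standing by (simp add: standing_assumption_def)
  then obtain x where "lower P < ereal x" "ereal x < upper P"
    using ereal_dense2 by blast
  then have "x \<in> S" by (simp add: states_def less_imp_le)
  then show ?thesis by auto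
qed

lemma bind_action_step:
  assumes "sets \<mu> = sets N" and d: "Measurable.pred N d"
  shows "\<mu> \<bind> action_step P (\<lambda>x. return_pmf (d x)) = distr \<mu> (pair_space P) (\<lambda>x. (x, d x))"
proof -
  have sp: "space \<mu> = S"
    using sets_eq_imp_space_eq[OF assms(1)] by simp
  have "\<mu> \<bind> action_step P (\<lambda>x. return_pmf (d x)) = \<mu> \<bind> (\<lambda>x. return (pair_space P) (x, d x))"
    by (rule bind_cong[OF refl]) (simp add: sp action_step_return_pmf)
  also have "\<dots> = distr \<mu> (pair_space P) (\<lambda>x. (x, d x))"
    using states_nonempty act_measurable[OF d]
    by (intro bind_return_distr') (simp_all add: sp measurable_cong_sets[OF assms(1) refl])
  finally show ?thesis .
qed

text \<open>The Markov kernel of the state-action chain after time 0: the action in \<open>p\<close>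
  drives the transition, and the threshold acts on the new state.\<close>

definition pair_step :: "ereal \<Rightarrow> real \<times> bool \<Rightarrow> (real \<times> bool) measure" where
  "pair_step z p = distr (transition P (snd p) (fst p)) (pair_space P) (\<lambda>y. (y, z < ereal y))"

lemma pair_step_measurable: "pair_step z \<in> pair_space P \<rightarrow>\<^sub>M subprob_algebra (pair_space P)"
proof -
  have "(\<lambda>p. transition P (snd p) (fst p)) \<in> pair_space P \<rightarrow>\<^sub>M subprob_algebra N"
    unfolding pair_space_def by (rule measurable_pair_discrete) (rule transition_subprob)
  from measurable_compose[OF this measurable_distr[OF act_measurable[OF pred_threshold]]]
  show ?thesis
    by (simp add: pair_step_def[abs_def])
qed

text \<open>Covers the \<open>z\<close>-policy and a prescribed first action followed by it at once:
  \<open>d\<close> decides at time 0, the threshold afterwards.\<close>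

definition follows :: "ereal \<Rightarrow> (real \<Rightarrow> bool) \<Rightarrow> policy \<Rightarrow> bool" where
  "follows z d \<pi> \<longleftrightarrow> nonanticipative P \<pi> \<and> Measurable.pred N d \<and>
     (\<forall>n h. \<pi> n h = (\<lambda>x. return_pmf (if n = 0 then d x else z < ereal x)))"

lemma follows_threshold: "follows z (\<lambda>x. z < ereal x) (threshold z)"
  by (simp add: follows_def nonanticipative_threshold) (simp add: threshold_def)

lemma follows_first_then: "follows z (\<lambda>x. a) (first_then a (threshold z))"
  by (simp add: follows_def nonanticipative_first_then nonanticipative_threshold)
     (auto simp: first_then_def threshold_def split: nat.split)

section \<open>Laws of the state-action pairs along a trajectory\<close>

context
  fixes \<nu> :: "real measure" and z :: ereal and d :: "real \<Rightarrow> bool" and \<pi> :: policy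
  assumes \<nu>: "\<nu> \<in> space (prob_algebra N)" and \<pi>: "follows z d \<pi>"
begin

interpretation IT: Ionescu_Tulcea "step_law P \<nu> \<pi>" "\<lambda>_. pair_space P"
  using Ionescu_Tulcea_step_law[OF standing \<nu>] \<pi> by (simp add: follows_def)

lemma decision_pred: "Measurable.pred N d"
  using \<pi> by (simp add: follows_def)

lemma sets_\<nu>: "sets \<nu> = sets N" and space_\<nu>: "space \<nu> = S"
  using \<nu> by (auto simp: space_prob_algebra dest: sets_eq_imp_space_eq)

definition marginal :: "nat \<Rightarrow> (real \<times> bool) measure" where
  "marginal n = distr (path_law P \<nu> \<pi>) (pair_space P) (\<lambda>\<omega>. \<omega> n)"

lemma component_measurable: "(\<lambda>\<omega>. \<omega> n) \<in> path_law P \<nu> \<pi> \<rightarrow>\<^sub>M pair_space P"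
  unfolding path_law_def by (simp add: measurable_cong_sets[OF IT.PF.sets_lim refl])

lemma marginal_0: "marginal 0 = distr \<nu> (pair_space P) (\<lambda>x. (x, d x))"
proof -
  have "marginal 0 = IT.C 0 0 (\<lambda>x. undefined) \<bind> step_law P \<nu> \<pi> 0"
    unfolding marginal_def path_law_def by (rule IT.distr_lim_component_bind)
  \<comment> \<open>\<open>IT.C 0 0\<close> is the point mass at the empty history.\<close>
  also have "\<dots> = step_law P \<nu> \<pi> 0 (\<lambda>x. undefined)"
    using bind_return[OF IT.P[of 0]] by simp
  also have "\<dots> = \<nu> \<bind> action_step P (\<lambda>x. return_pmf (d x))"
    using \<pi> by (simp add: step_law_def follows_def)
  finally show ?thesis
    by (simp add: bind_action_step sets_\<nu> decision_pred)
qed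

text \<open>The Markov property: after time 0 the step law depends on the history only through the
  last pair, so the joint law of the history can be replaced by its last marginal.\<close>

lemma marginal_Suc: "marginal (Suc n) = marginal n \<bind> pair_step z"
proof -
  let ?C = "IT.C 0 (Suc n) (\<lambda>x. undefined)"
  have u: "(\<lambda>x. undefined) \<in> space (PiM {0..<0::nat} (\<lambda>_. pair_space P))"
    by simp
  have s: "sets ?C = sets (PiM {0..<Suc n} (\<lambda>_. pair_space P))"
    using IT.sets_C[OF u, of "Suc n"] by simp
  have "marginal (Suc n) = ?C \<bind> step_law P \<nu> \<pi> (Suc n)"
    unfolding marginal_def path_law_def by (rule IT.distr_lim_component_bind)
  also have "\<dots> = ?C \<bind> (\<lambda>h. pair_step z (h n))"
  proof (rule bind_cong[OF refl])
    fix h assume "h \<in> space ?C"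
    then have "h \<in> space (PiM {0..<Suc n} (\<lambda>_. pair_space P))"
      by (simp only: sets_eq_imp_space_eq[OF s])
    then have "h n \<in> space (pair_space P)"
      by (auto simp: space_PiM)
    then have "fst (h n) \<in> S"
      by (auto simp: space_pair)
    then show "step_law P \<nu> \<pi> (Suc n) h = pair_step z (h n)"
      using \<pi> by (simp add: step_law_def follows_def pair_step_def bind_action_step sets_transition)
  qed
  also have "\<dots> = distr ?C (pair_space P) (\<lambda>h. h n) \<bind> pair_step z"
    by (rule bind_distr[symmetric, OF _ pair_step_measurable prob_space.not_empty[OF IT.prob_space_C[OF u]]])
       (simp add: measurable_cong_sets[OF s refl] del: IT.C.simps)
  also have "distr ?C (pair_space P) (\<lambda>h. h n) = marginal n"
    unfolding marginal_def path_law_def by (rule IT.distr_lim_component[symmetric])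
  finally show ?thesis .
qed

lemma sets_marginal: "sets (marginal n) = sets (pair_space P)"
  by (simp add: marginal_def)

lemma space_marginal: "space (marginal n) = S \<times> UNIV"
  by (simp add: marginal_def space_pair)

lemma nn_integral_pair_step:
  assumes "p \<in> S \<times> UNIV" and [measurable]: "f \<in> borel_measurable (pair_space P)"
  shows "(\<integral>\<^sup>+q. f q \<partial>pair_step z p) = (\<integral>\<^sup>+y. f (y, z < ereal y) \<partial>transition P (snd p) (fst p))"
  using assms(1) act_measurable[OF pred_threshold, of z] unfolding pair_step_def
  by (intro nn_integral_distr) (auto simp: measurable_cong_sets[OF sets_transition refl])

text \<open>The drift inequality iterated along the chain. The power of \<beta> multiplies the
  integral because for \<beta> = 0 the integral alone may be infinite.\<close>

lemma nn_integral_marginal_weight: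
  "ennreal (\<beta> ^ n) * (\<integral>\<^sup>+p. ennreal (w (fst p)) \<partial>marginal n) \<le> ennreal (\<gamma> ^ n) * (\<integral>\<^sup>+x. ennreal (w x) \<partial>\<nu>)"
proof (induction n)
  case 0
  have "(\<integral>\<^sup>+p. ennreal (w (fst p)) \<partial>marginal 0) = (\<integral>\<^sup>+x. ennreal (w x) \<partial>\<nu>)"
    unfolding marginal_0 using act_measurable[OF decision_pred]
    by (subst nn_integral_distr) (auto simp: measurable_cong_sets[OF sets_\<nu> refl])
  then show ?case by simp
next
  case (Suc n)
  have "(\<integral>\<^sup>+p. ennreal (w (fst p)) \<partial>marginal (Suc n)) =
      (\<integral>\<^sup>+p. \<integral>\<^sup>+q. ennreal (w (fst q)) \<partial>pair_step z p \<partial>marginal n)"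
    unfolding marginal_Suc
    using pair_step_measurable[of z]
    by (intro nn_integral_bind[where B="pair_space P"]) (simp_all add: measurable_cong_sets[OF sets_marginal refl])
  also have "\<dots> = (\<integral>\<^sup>+p. \<integral>\<^sup>+y. ennreal (w y) \<partial>transition P (snd p) (fst p) \<partial>marginal n)"
    by (intro nn_integral_cong) (simp add: space_marginal nn_integral_pair_step)
  finally have "ennreal \<beta> * (\<integral>\<^sup>+p. ennreal (w (fst p)) \<partial>marginal (Suc n)) =
      ennreal \<beta> * (\<integral>\<^sup>+p. \<integral>\<^sup>+y. ennreal (w y) \<partial>transition P (snd p) (fst p) \<partial>marginal n)"
    by simp
  also have "\<dots> = (\<integral>\<^sup>+p. ennreal \<beta> * (\<integral>\<^sup>+y. ennreal (w y) \<partial>transition P (snd p) (fst p)) \<partial>marginal n)"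
  proof (rule nn_integral_cmult[symmetric])
    have "(\<lambda>p. (\<integral>\<^sup>+y. ennreal (w y) \<partial>transition P (snd p) (fst p))) \<in> borel_measurable (pair_space P)"
      unfolding pair_space_def by (rule measurable_pair_discrete) measurable
    then show "(\<lambda>p. (\<integral>\<^sup>+y. ennreal (w y) \<partial>transition P (snd p) (fst p))) \<in> borel_measurable (marginal n)"
      by (simp add: measurable_cong_sets[OF sets_marginal refl])
  qed
  also have "\<dots> \<le> (\<integral>\<^sup>+p. ennreal (\<gamma> * w (fst p)) \<partial>marginal n)"
    by (intro nn_integral_mono nn_integral_weight) (auto simp: space_marginal)
  also have "\<dots> = ennreal \<gamma> * (\<integral>\<^sup>+p. ennreal (w (fst p)) \<partial>marginal n)"
    using gamma by (subst nn_integral_cmult[symmetric])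
      (auto simp: measurable_cong_sets[OF sets_marginal refl] ennreal_mult' intro!: nn_integral_cong)
  finally have "ennreal (\<beta> ^ n) * (ennreal \<beta> * (\<integral>\<^sup>+p. ennreal (w (fst p)) \<partial>marginal (Suc n)))
      \<le> ennreal (\<beta> ^ n) * (ennreal \<gamma> * (\<integral>\<^sup>+p. ennreal (w (fst p)) \<partial>marginal n))"
    by (rule mult_left_mono) simp
  also have "\<dots> = ennreal \<gamma> * (ennreal (\<beta> ^ n) * (\<integral>\<^sup>+p. ennreal (w (fst p)) \<partial>marginal n))"
    by (simp add: mult_ac)
  also have "\<dots> \<le> ennreal \<gamma> * (ennreal (\<gamma> ^ n) * (\<integral>\<^sup>+x. ennreal (w x) \<partial>\<nu>))"
    by (rule mult_left_mono[OF Suc]) simp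
  finally show ?case
    using gamma discount_nonneg by (simp add: ennreal_mult mult_ac)
qed

lemma pair_function_measurable:
  "weight_bounded C f \<Longrightarrow> (\<lambda>p. f (fst p) (snd p)) \<in> borel_measurable (pair_space P)"
  unfolding pair_space_def by (rule measurable_pair_discrete[of "\<lambda>a x. f x a"]) (rule weight_boundedD)

text \<open>Moving the law forward one step amounts to moving the integrand back by
  \<open>lookahead\<close>. The induction therefore replaces \<open>f\<close> by
  \<open>lookahead z f\<close>, and \<open>f\<close> and \<open>C\<close> must be arbitrary in
  it.\<close>

lemma integral_marginal:
  assumes fin: "(\<integral>\<^sup>+x. ennreal (w x) \<partial>\<nu>) < \<infinity>" and f: "weight_bounded C f"
  shows "\<beta> ^ n * (\<integral>p. f (fst p) (snd p) \<partial>marginal n) = (\<integral>x. (lookahead z ^^ n) f x (d x) \<partial>\<nu>)"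
  using f
proof (induction n arbitrary: C f)
  case 0
  then show ?case
    unfolding marginal_0 using act_measurable[OF decision_pred] pair_function_measurable[OF 0]
    by (subst integral_distr) (auto simp: measurable_cong_sets[OF sets_\<nu> refl])
next
  case (Suc n)
  show ?case
  proof (cases "\<beta> = 0")
    \<comment> \<open>Both sides vanish: on the right, the outermost \<open>lookahead\<close>
      carries a factor \<beta>.\<close>
    case True
    then show ?thesis by (simp add: lookahead_def step_def)
  next
    case False
    then have \<beta>: "0 < \<beta>" using discount_nonneg by simp
    note f = pair_function_measurable[OF Suc.prems]
    note pm = pair_step_measurable[of z]
    have K: "pair_step z \<in> marginal n \<rightarrow>\<^sub>M subprob_algebra (pair_space P)"
      using pm by (simp add: measurable_cong_sets[OF sets_marginal refl])
    have ne: "space (marginal n) \<noteq> {}"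
      using states_nonempty by (simp add: space_marginal)
    have sp: "space (marginal n) = space (pair_space P)"
      by (simp add: space_marginal space_pair)
    have C: "0 \<le> C"
      using states_nonempty weight_bounded_nonneg[OF Suc.prems] by auto
    \<comment> \<open>Here \<beta> is positive, so finiteness of the discounted integral gives that
      of the integral itself.\<close>
    have wfin: "(\<integral>\<^sup>+p. ennreal (w (fst p)) \<partial>marginal (Suc n)) < \<infinity>"
    proof -
      have "ennreal (\<beta> ^ Suc n) * (\<integral>\<^sup>+p. ennreal (w (fst p)) \<partial>marginal (Suc n)) < \<infinity>"
        by (rule le_less_trans[OF nn_integral_marginal_weight]) (use fin in \<open>simp add: ennreal_mult_less_top\<close>)
      then show ?thesis
        using \<beta> by (auto simp add: ennreal_mult_less_top simp del: power_Suc)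
    qed
    have "(\<integral>\<^sup>+p. \<integral>\<^sup>+q. ennreal \<bar>f (fst q) (snd q)\<bar> \<partial>pair_step z p \<partial>marginal n) =
        (\<integral>\<^sup>+q. ennreal \<bar>f (fst q) (snd q)\<bar> \<partial>marginal (Suc n))"
      unfolding marginal_Suc
      by (intro nn_integral_bind[OF _ K, symmetric] measurable_compose[OF _ measurable_ennreal]
          borel_measurable_abs f)
    also have "\<dots> \<le> (\<integral>\<^sup>+q. ennreal C * ennreal (w (fst q)) \<partial>marginal (Suc n))"
      using weight_boundedD(2)[OF Suc.prems] C
      by (intro nn_integral_mono) (auto simp: space_marginal ennreal_mult'[symmetric] intro!: ennreal_leI)
    also have "\<dots> = ennreal C * (\<integral>\<^sup>+q. ennreal (w (fst q)) \<partial>marginal (Suc n))"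
      by (intro nn_integral_cmult) (simp add: measurable_cong_sets[OF sets_marginal refl])
    also have "\<dots> < \<infinity>"
      using wfin by (simp add: ennreal_mult_less_top)
    finally have "(\<integral>q. f (fst q) (snd q) \<partial>marginal (Suc n)) =
        (\<integral>p. \<integral>q. f (fst q) (snd q) \<partial>pair_step z p \<partial>marginal n)"
      unfolding marginal_Suc by (intro integral_bind_kernel[OF K ne f])
    also have "\<dots> = (\<integral>p. \<integral>y. closed_loop z f y \<partial>transition P (snd p) (fst p) \<partial>marginal n)"
    proof (rule Bochner_Integration.integral_cong[OF refl])
      fix p assume "p \<in> space (marginal n)"
      then have "fst p \<in> S" by (auto simp: space_marginal)
      then show "(\<integral>q. f (fst q) (snd q) \<partial>pair_step z p) = (\<integral>y. closed_loop z f y \<partial>transition P (snd p) (fst p))"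
        unfolding pair_step_def closed_loop_def using act_measurable[OF pred_threshold, of z] f
        by (subst integral_distr) (auto simp: measurable_cong_sets[OF sets_transition refl])
    qed
    finally have "\<beta> * (\<integral>q. f (fst q) (snd q) \<partial>marginal (Suc n)) =
        (\<integral>p. lookahead z f (fst p) (snd p) \<partial>marginal n)"
      by (simp add: lookahead_def step_def)
    then have "\<beta> ^ Suc n * (\<integral>q. f (fst q) (snd q) \<partial>marginal (Suc n)) =
        \<beta> ^ n * (\<integral>p. lookahead z f (fst p) (snd p) \<partial>marginal n)"
      by (simp only: power_Suc2 mult.assoc)
    then show ?thesis
      using Suc.IH[OF weight_bounded_lookahead[OF Suc.prems, where z=z]]
      by (simp add: funpow_swap1)
  qed
qed

text \<open>Geometric bounds allow the sum to leave the integral over trajectories; each term is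
  then rewritten by \<open>integral_marginal\<close>, and the sum reenters the integral over
  \<nu>.\<close>

lemma total_discounted_eq:
  assumes fin: "(\<integral>\<^sup>+x. ennreal (w x) \<partial>\<nu>) < \<infinity>" and f: "weight_bounded C f"
  shows "total_discounted P f \<nu> \<pi> = (\<integral>x. q_value z f x (d x) \<partial>\<nu>)"
proof -
  let ?f = "\<lambda>t \<omega>. \<beta> ^ t * f (fst (\<omega> t)) (snd (\<omega> t))"
  obtain W where W: "0 \<le> W" "(\<integral>\<^sup>+x. ennreal (w x) \<partial>\<nu>) = ennreal W"
    using fin by (cases "\<integral>\<^sup>+x. ennreal (w x) \<partial>\<nu>") auto
  have C: "0 \<le> C"
    using states_nonempty weight_bounded_nonneg[OF f] by auto
  note fm = pair_function_measurable[OF f]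
  have meas: "?f t \<in> borel_measurable (path_law P \<nu> \<pi>)" for t
    using measurable_compose[OF component_measurable fm] by (intro borel_measurable_times) auto
  have bound: "(\<integral>\<^sup>+\<omega>. ennreal \<bar>?f t \<omega>\<bar> \<partial>path_law P \<nu> \<pi>) \<le> ennreal (C * W * \<gamma> ^ t)" for t
  proof -
    have "(\<integral>\<^sup>+\<omega>. ennreal \<bar>?f t \<omega>\<bar> \<partial>path_law P \<nu> \<pi>) =
        (\<integral>\<^sup>+p. ennreal \<bar>\<beta> ^ t * f (fst p) (snd p)\<bar> \<partial>marginal t)"
      unfolding marginal_def using component_measurable[of t] fm
      by (subst nn_integral_distr) auto
    also have "\<dots> \<le> (\<integral>\<^sup>+p. ennreal (C * \<beta> ^ t) * ennreal (w (fst p)) \<partial>marginal t)"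
    proof (rule nn_integral_mono)
      fix p assume "p \<in> space (marginal t)"
      then have p: "fst p \<in> S" by (auto simp: space_marginal)
      have "\<beta> ^ t * \<bar>f (fst p) (snd p)\<bar> \<le> \<beta> ^ t * (C * w (fst p))"
        using weight_boundedD(2)[OF f p] discount_nonneg by (intro mult_left_mono) auto
      then show "ennreal \<bar>\<beta> ^ t * f (fst p) (snd p)\<bar> \<le> ennreal (C * \<beta> ^ t) * ennreal (w (fst p))"
        using discount_nonneg C
        by (subst ennreal_mult'[symmetric]) (auto simp: abs_mult mult_ac intro!: ennreal_leI)
    qed
    also have "\<dots> = ennreal C * (ennreal (\<beta> ^ t) * (\<integral>\<^sup>+p. ennreal (w (fst p)) \<partial>marginal t))"
      using C discount_nonneg
      by (subst nn_integral_cmult) (auto simp: measurable_cong_sets[OF sets_marginal refl] ennreal_mult mult_ac)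
    also have "\<dots> \<le> ennreal C * (ennreal (\<gamma> ^ t) * ennreal W)"
      using nn_integral_marginal_weight[of t] unfolding W by (rule mult_left_mono) simp
    also have "\<dots> = ennreal (C * W * \<gamma> ^ t)"
      using C W gamma by (simp add: ennreal_mult[symmetric] mult_ac)
    finally show ?thesis .
  qed
  have CW: "0 \<le> C * W * \<gamma> ^ t" for t
    using C W gamma by simp
  have sm: "summable (\<lambda>t. C * W * \<gamma> ^ t)"
    using gamma by (intro summable_mult summable_geometric) simp
  have int: "integrable (path_law P \<nu> \<pi>) (?f t)" for t
    by (rule integrableI_bounded[OF meas])
       (use le_less_trans[OF bound[of t] ennreal_less_top] in \<open>unfold real_norm_def infinity_ennreal_def\<close>)
  have norm_bound: "(\<integral>\<omega>. norm (?f t \<omega>) \<partial>path_law P \<nu> \<pi>) \<le> C * W * \<gamma> ^ t" for t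
  proof -
    have "ennreal (\<integral>\<omega>. norm (?f t \<omega>) \<partial>path_law P \<nu> \<pi>) = (\<integral>\<^sup>+\<omega>. ennreal (norm (?f t \<omega>)) \<partial>path_law P \<nu> \<pi>)"
      by (rule nn_integral_eq_integral[symmetric, OF integrable_norm[OF int]]) simp
    also have "\<dots> \<le> ennreal (C * W * \<gamma> ^ t)"
      using bound[of t] by simp
    finally show ?thesis
      using CW by (simp add: ennreal_le_iff)
  qed
  \<comment> \<open>The expected sum of absolute values is finite, so the reward series converges
    absolutely along almost every trajectory.\<close>
  have "AE \<omega> in path_law P \<nu> \<pi>. summable (\<lambda>t. norm (?f t \<omega>))"
  proof -
    have "(\<integral>\<^sup>+\<omega>. (\<Sum>t. ennreal (norm (?f t \<omega>))) \<partial>path_law P \<nu> \<pi>) =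
        (\<Sum>t. \<integral>\<^sup>+\<omega>. ennreal (norm (?f t \<omega>)) \<partial>path_law P \<nu> \<pi>)"
      using meas by (intro nn_integral_suminf) simp
    also have "\<dots> \<le> (\<Sum>t. ennreal (C * W * \<gamma> ^ t))"
      using bound by (intro suminf_le) auto
    also have "\<dots> < \<infinity>"
      using ennreal_suminf_neq_top[OF sm CW] by (simp add: less_top)
    finally have "AE \<omega> in path_law P \<nu> \<pi>. (\<Sum>t. ennreal (norm (?f t \<omega>))) \<noteq> \<infinity>"
      using meas by (intro nn_integral_PInf_AE) auto
    then show ?thesis
      by eventually_elim (auto intro: summable_suminf_not_top)
  qed
  moreover have "summable (\<lambda>t. \<integral>\<omega>. norm (?f t \<omega>) \<partial>path_law P \<nu> \<pi>)"
    by (rule summable_comparison_test'[OF sm]) (use norm_bound in \<open>simp add: integral_nonneg_AE\<close>)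
  ultimately have "total_discounted P f \<nu> \<pi> = (\<Sum>t. \<integral>\<omega>. ?f t \<omega> \<partial>path_law P \<nu> \<pi>)"
    unfolding total_discounted_def by (intro integral_suminf int)
  also have "\<dots> = (\<Sum>t. \<integral>x. (lookahead z ^^ t) f x (d x) \<partial>\<nu>)"
  proof (rule arg_cong[where f=suminf], rule ext)
    fix t
    have "(\<integral>\<omega>. ?f t \<omega> \<partial>path_law P \<nu> \<pi>) = (\<integral>p. \<beta> ^ t * f (fst p) (snd p) \<partial>marginal t)"
      unfolding marginal_def using component_measurable[of t] fm
      by (subst integral_distr) auto
    then show "(\<integral>\<omega>. ?f t \<omega> \<partial>path_law P \<nu> \<pi>) = (\<integral>x. (lookahead z ^^ t) f x (d x) \<partial>\<nu>)"
      using integral_marginal[OF fin f, of t] by simp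
  qed
  \<comment> \<open>The second exchange of sum and integral, over initial states, with
    \<open>C * \<gamma> ^ t * w x\<close> as the bound on the terms.\<close>
  also have "\<dots> = (\<integral>x. q_value z f x (d x) \<partial>\<nu>)"
    unfolding q_value_def
  proof (rule integral_suminf[symmetric])
    let ?u = "\<lambda>t x. (lookahead z ^^ t) f x (d x)"
    note wb = weight_bounded_iter[OF f, where z=z]
    have um: "?u t \<in> borel_measurable \<nu>" for t
      using decision_measurable[OF weight_boundedD(1)[OF wb] decision_pred]
      by (simp add: measurable_cong_sets[OF sets_\<nu> refl])
    have wm: "w \<in> borel_measurable \<nu>"
      by (simp add: measurable_cong_sets[OF sets_\<nu> refl])
    have "(\<integral>\<^sup>+x. ennreal (norm (w x)) \<partial>\<nu>) = (\<integral>\<^sup>+x. ennreal (w x) \<partial>\<nu>)"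
      using weight_ge_1 by (intro nn_integral_cong) (force simp: space_\<nu>)
    then have wi: "integrable \<nu> w"
      using fin wm by (simp add: integrable_iff_bounded)
    have ub: "norm (?u t x) \<le> C * \<gamma> ^ t * w x" if "x \<in> space \<nu>" for t x
      using weight_boundedD(2)[OF wb] that by (simp add: space_\<nu>)
    show ui: "integrable \<nu> (?u t)" for t
      by (rule Bochner_Integration.integrable_bound[OF integrable_mult_right[OF wi, of "C * \<gamma> ^ t"] um])
         (intro AE_I2 order_trans[OF ub], simp_all)
    show "AE x in \<nu>. summable (\<lambda>t. norm (?u t x))"
      using iter_summable[OF f] by (intro AE_I2) (simp add: space_\<nu>)
    show "summable (\<lambda>t. \<integral>x. norm (?u t x) \<partial>\<nu>)"
    proof (rule summable_comparison_test')
      show "summable (\<lambda>t. C * (\<integral>x. w x \<partial>\<nu>) * \<gamma> ^ t)"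
        using gamma by (intro summable_mult summable_geometric) simp
      show "norm (\<integral>x. norm (?u t x) \<partial>\<nu>) \<le> C * (\<integral>x. w x \<partial>\<nu>) * \<gamma> ^ t" for t
      proof -
        have "(\<integral>x. norm (?u t x) \<partial>\<nu>) \<le> (\<integral>x. C * \<gamma> ^ t * w x \<partial>\<nu>)"
          by (intro integral_mono integrable_norm ui integrable_mult_right wi ub)
        then show ?thesis by (simp add: integral_nonneg_AE mult_ac)
      qed
    qed
  qed
  finally show ?thesis .
qed

end

section \<open>Dependence on the threshold\<close>

lemma weight_bounded_reward: "weight_bounded M (reward P)"
  and weight_bounded_resource: "weight_bounded M (resource P)"
proof -
  have "continuous_on S (\<lambda>x. reward P x a)" "continuous_on S (\<lambda>x. resource P x a)" for a
    using standing by (auto simp: standing_assumption_def)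
  then have "(\<lambda>x. reward P x a) \<in> borel_measurable N" "(\<lambda>x. resource P x a) \<in> borel_measurable N" for a
    unfolding state_space_def by (auto intro: borel_measurable_continuous_on_restrict)
  moreover have "\<bar>reward P x a\<bar> \<le> M * w x" "\<bar>resource P x a\<bar> \<le> M * w x" if "x \<in> S" for x a
  proof -
    \<comment> \<open>The standing assumption bounds the resource from above only; its sign turns
      this into a bound on the absolute value.\<close>
    have "0 \<le> resource P x a"
      using standing that by (cases a) (force simp: standing_assumption_def)+
    moreover have "max \<bar>reward P x a\<bar> (resource P x a) \<le> M * w x"
      using standing that by (auto simp: standing_assumption_def)
    ultimately show "\<bar>reward P x a\<bar> \<le> M * w x" "\<bar>resource P x a\<bar> \<le> M * w x"
      by auto
  qed
  ultimately show "weight_bounded M (reward P)" "weight_bounded M (resource P)"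
    by (auto simp: weight_bounded_def)
qed

text \<open>At a state this is the metric of the \<open>z\<close>-policy started there:
  \<open>F_metric\<close> when \<open>f\<close> is the reward, \<open>G_metric\<close> when
  \<open>f\<close> is the resource.\<close>

definition threshold_value :: "ereal \<Rightarrow> (real \<Rightarrow> bool \<Rightarrow> real) \<Rightarrow> real \<Rightarrow> real" where
  "threshold_value z f = closed_loop z (q_value z f)"

lemma q_value_step:
  "weight_bounded C f \<Longrightarrow> x \<in> S \<Longrightarrow> q_value z f x a = f x a + step a (threshold_value z f) x"
  using q_value_eq[of C f x z a] by (simp add: lookahead_def threshold_value_def)

lemma threshold_value_measurable:
  "weight_bounded C f \<Longrightarrow> threshold_value z f \<in> borel_measurable N"
  unfolding threshold_value_def by (rule closed_loop_measurable[OF weight_bounded_q_value])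

lemma threshold_value_bound:
  "weight_bounded C f \<Longrightarrow> x \<in> S \<Longrightarrow> \<bar>threshold_value z f x\<bar> \<le> C / (1 - \<gamma>) * w x"
  unfolding threshold_value_def by (rule closed_loop_bound[OF weight_bounded_q_value])

lemma total_discounted_threshold:
  assumes "\<nu> \<in> prob_w P w" "weight_bounded C f"
  shows "total_discounted P f \<nu> (threshold z) = (\<integral>x. threshold_value z f x \<partial>\<nu>)"
  using total_discounted_eq[OF _ follows_threshold _ assms(2)] assms(1)
  by (simp add: prob_w_def threshold_value_def closed_loop_def)

lemma
  assumes x: "x \<in> S"
  shows dirac_in_prob_w: "dirac P x \<in> prob_w P w"
    and integral_dirac: "\<phi> \<in> borel_measurable N \<Longrightarrow> (\<integral>y. \<phi> y \<partial>dirac P x) = (\<phi> x :: real)"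
  using x by (auto simp: prob_w_def space_prob_algebra prob_space_return nn_integral_return integral_return)

lemma total_discounted_threshold_dirac:
  assumes "x \<in> S" "weight_bounded C f"
  shows "total_discounted P f (dirac P x) (threshold z) = threshold_value z f x"
  using total_discounted_threshold[OF dirac_in_prob_w[OF assms(1)] assms(2)]
  by (simp add: integral_dirac[OF assms(1) threshold_value_measurable[OF assms(2)]])

lemma total_discounted_first_then:
  assumes x: "x \<in> S" and f: "weight_bounded C f"
  shows "total_discounted P f (dirac P x) (first_then a (threshold z)) = q_value z f x a"
  using total_discounted_eq[OF _ follows_first_then _ f, of "dirac P x"] dirac_in_prob_w[OF x]
    integral_dirac[OF x weight_boundedD(1)[OF weight_bounded_q_value[OF f]]]
  by (simp add: prob_w_def)

text \<open>Iterating the inequality \<open>n\<close> times gives \<open>- C \<gamma>\<^sup>n w \<le> \<phi>\<close>.\<close>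
lemma supersolution_nonneg:
  assumes \<phi>: "\<phi> \<in> borel_measurable N" "\<And>y. y \<in> S \<Longrightarrow> \<bar>\<phi> y\<bar> \<le> C * w y"
    and super: "\<And>y. y \<in> S \<Longrightarrow> step (a y) \<phi> y \<le> \<phi> y"
    and x: "x \<in> S"
  shows "0 \<le> \<phi> x"
proof -
  have C: "0 \<le> C"
  proof -
    have "0 \<le> C * w x" using \<phi>(2)[OF x] by (rule order_trans[OF abs_ge_zero])
    then show ?thesis using weight_ge_1[OF x] by (simp add: zero_le_mult_iff)
  qed
  have lower: "- (C * \<gamma> ^ n) * w y \<le> \<phi> y" if "y \<in> S" for n y
    using that
  proof (induction n arbitrary: y)
    case 0
    then show ?case using \<phi>(2)[of y] by simp
  next
    case (Suc n)
    have bd: "\<bar>- (C * \<gamma> ^ n) * w u\<bar> \<le> C * \<gamma> ^ n * w u" if "u \<in> S" for u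
      using C gamma weight_ge_1[OF that] by (simp add: abs_mult)
    have "C * \<gamma> ^ n * step (a y) w y \<le> C * \<gamma> ^ n * (\<gamma> * w y)"
      using C gamma step_weight[OF Suc.prems] by (intro mult_left_mono) auto
    then have "- (C * \<gamma> ^ Suc n) * w y \<le> step (a y) (\<lambda>u. - (C * \<gamma> ^ n) * w u) y"
      unfolding step_scaled_weight by (simp add: mult_ac)
    also have "\<dots> \<le> step (a y) \<phi> y"
      by (rule step_mono[OF Suc.prems _ \<phi>(1) bd \<phi>(2) Suc.IH]) auto
    also have "\<dots> \<le> \<phi> y"
      by (rule super[OF Suc.prems])
    finally show ?case .
  qed
  have "(\<lambda>n. - (C * \<gamma> ^ n) * w x) \<longlonglongrightarrow> - (C * 0) * w x"
    using gamma by (intro tendsto_intros LIMSEQ_realpow_zero) auto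
  then show ?thesis
    using lower[OF x] by (intro LIMSEQ_le_const2[of "\<lambda>n. - (C * \<gamma> ^ n) * w x" 0]) auto
qed

text \<open>For the resource this is the marginal metric \<open>g_marginal\<close> under the
  \<open>z\<close>-policy.\<close>

definition advantage :: "ereal \<Rightarrow> (real \<Rightarrow> bool \<Rightarrow> real) \<Rightarrow> real \<Rightarrow> real" where
  "advantage z f x = q_value z f x True - q_value z f x False"

text \<open>Compare both values with \<open>q_value z2 f x (z1 < ereal x)\<close>, which takes the
  action of \<open>z1\<close> first and follows \<open>z2\<close> afterwards. It differs from the
  \<open>z1\<close> value by one discounted step, and from the \<open>z2\<close> value only where
  the two thresholds disagree, by the advantage.\<close>

lemma threshold_value_diff:
  assumes f: "weight_bounded C f" and x: "x \<in> S" and z: "z1 \<le> z2"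
  shows "threshold_value z1 f x - threshold_value z2 f x =
    (if z1 < ereal x \<and> ereal x \<le> z2 then advantage z2 f x else 0) +
    step (z1 < ereal x) (\<lambda>y. threshold_value z1 f y - threshold_value z2 f y) x"
proof -
  note m = threshold_value_measurable[OF f]
  note b = threshold_value_bound[OF f]
  have "step (z1 < ereal x) (\<lambda>y. threshold_value z1 f y - threshold_value z2 f y) x =
      step (z1 < ereal x) (threshold_value z1 f) x - step (z1 < ereal x) (threshold_value z2 f) x"
    by (rule step_diff[OF x m m b b])
  also have "\<dots> = q_value z1 f x (z1 < ereal x) - q_value z2 f x (z1 < ereal x)"
    by (simp add: q_value_step[OF f x])
  finally have eq: "step (z1 < ereal x) (\<lambda>y. threshold_value z1 f y - threshold_value z2 f y) x =
      q_value z1 f x (z1 < ereal x) - q_value z2 f x (z1 < ereal x)" .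
  have "z1 < ereal x" if "z2 < ereal x"
    using z that by (rule le_less_trans)
  moreover have "ereal x \<le> z2 \<longleftrightarrow> \<not> z2 < ereal x"
    by (simp add: not_less)
  ultimately show ?thesis
    unfolding eq by (cases "z1 < ereal x"; cases "z2 < ereal x")
      (simp_all add: threshold_value_def closed_loop_def advantage_def)
qed

text \<open>The source term in \<open>threshold_value_diff\<close> is nonnegative, so the difference
  is a supersolution of the homogeneous equation.\<close>

lemma threshold_value_antimono:
  assumes f: "weight_bounded C f" and pos: "\<And>x z. x \<in> S \<Longrightarrow> 0 < advantage z f x"
    and x: "x \<in> S" and z: "z1 \<le> z2"
  shows "threshold_value z2 f x \<le> threshold_value z1 f x"
proof -
  note m = threshold_value_measurable[OF f]
  let ?D = "\<lambda>y. threshold_value z1 f y - threshold_value z2 f y"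
  have "0 \<le> ?D x"
  proof (rule supersolution_nonneg[OF _ _ _ x, where a="\<lambda>y. z1 < ereal y"])
    show "\<bar>?D y\<bar> \<le> (2 * (C / (1 - \<gamma>))) * w y" if "y \<in> S" for y
      using threshold_value_bound[OF f that, of z1] threshold_value_bound[OF f that, of z2] by linarith
    show "step (z1 < ereal y) ?D y \<le> ?D y" if "y \<in> S" for y
      using threshold_value_diff[OF f that z] pos[OF that, of z2] by simp
  qed (use m in simp)
  then show ?thesis by simp
qed

text \<open>Monotonicity in the threshold makes the gaps \<open>D n\<close> decrease to a limit
  \<open>L\<close>. This limit solves the homogeneous equation, so
  \<open>supersolution_nonneg\<close> applies to its negative and leaves only
  \<open>L x = 0\<close>.\<close>

lemma threshold_value_right_continuous:
  assumes f: "weight_bounded C f" and pos: "\<And>x z. x \<in> S \<Longrightarrow> 0 < advantage z f x"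
    and x: "x \<in> S"
  shows "continuous (at_right z) (\<lambda>z. threshold_value (ereal z) f x)"
  unfolding continuous_within
proof (rule tendsto_at_right_sequentially[of z "z + 1"])
  fix s :: "nat \<Rightarrow> real"
  assume s: "\<And>n. z < s n" "decseq s" "s \<longlonglongrightarrow> z"
  note m = threshold_value_measurable[OF f]
  define D where "D n y = threshold_value (ereal z) f y - threshold_value (ereal (s n)) f y" for n y
  define L where "L y = lim (\<lambda>n. D n y)" for y
  let ?C = "2 * (C / (1 - \<gamma>))"
  have bound: "\<bar>D n y\<bar> \<le> ?C * w y" if "y \<in> S" for n y
    unfolding D_def
    using threshold_value_bound[OF f that, of "ereal z"] threshold_value_bound[OF f that, of "ereal (s n)"]
    by linarith
  have meas: "D n \<in> borel_measurable N" for n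
    unfolding D_def[abs_def] by (intro borel_measurable_diff m)
  have D_nonneg: "0 \<le> D n y" if "y \<in> S" for n y
    using threshold_value_antimono[OF f pos that, of "ereal z" "ereal (s n)"] s(1)[of n] by (simp add: D_def)
  have D_dec: "decseq (\<lambda>n. D n y)" if "y \<in> S" for y
    using threshold_value_antimono[OF f pos that] s(2) by (auto simp: decseq_def D_def)
  have lim: "(\<lambda>n. D n y) \<longlonglongrightarrow> L y" if "y \<in> S" for y
  proof -
    have "convergent (\<lambda>n. D n y)"
      using decseq_convergent[OF D_dec[OF that], of 0] D_nonneg[OF that] by (metis convergentI)
    then obtain l where "(\<lambda>n. D n y) \<longlonglongrightarrow> l"
      by (auto simp: convergent_def)
    then show ?thesis by (simp add: L_def limI)
  qed
  have L_meas: "L \<in> borel_measurable N"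
    unfolding L_def[abs_def] using meas by (rule borel_measurable_lim_metric)
  have L_bound: "\<bar>L y\<bar> \<le> ?C * w y" if "y \<in> S" for y
    by (rule LIMSEQ_le_const2[OF tendsto_rabs[OF lim[OF that]]]) (use bound[OF that] in blast)
  have L_eq: "L y = step (z < y) L y" if y: "y \<in> S" for y
  proof -
    \<comment> \<open>The window \<open>{z<..s n}\<close> shrinks to the empty set: each fixed state
      leaves it, and the source term disappears there.\<close>
    have "eventually (\<lambda>n. \<not> (z < y \<and> y \<le> s n)) sequentially"
    proof (cases "z < y")
      case True
      then show ?thesis using order_tendstoD(2)[OF s(3) True] by (auto elim: eventually_mono)
    qed simp
    then have "eventually (\<lambda>n. D n y = step (z < y) (D n) y) sequentially"
    proof eventually_elim
      case (elim n)
      then show ?case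
        using threshold_value_diff[OF f y, of "ereal z" "ereal (s n)"] s(1)[of n]
        by (auto simp: D_def[abs_def])
    qed
    then have "(\<lambda>n. step (z < y) (D n) y) \<longlonglongrightarrow> L y"
      using lim[OF y] by (rule Lim_transform_eventually[rotated])
    moreover have "(\<lambda>n. step (z < y) (D n) y) \<longlonglongrightarrow> step (z < y) L y"
      by (rule step_tendsto[OF y meas L_meas bound lim])
    ultimately show ?thesis by (rule LIMSEQ_unique)
  qed
  have "0 \<le> - L x"
  proof (rule supersolution_nonneg[OF _ _ _ x, where a="\<lambda>y. z < y" and C="?C"])
    show "step (z < y) (\<lambda>y. - L y) y \<le> - L y" if "y \<in> S" for y
      using L_eq[OF that] by (simp add: step_minus)
  qed (use L_meas L_bound in auto)
  moreover have "0 \<le> L x"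
    by (rule LIMSEQ_le_const[OF lim[OF x]]) (use D_nonneg[OF x] in blast)
  ultimately have "(\<lambda>n. D n x) \<longlonglongrightarrow> 0"
    using lim[OF x] by simp
  then have "(\<lambda>n. threshold_value (ereal z) f x - D n x) \<longlonglongrightarrow> threshold_value (ereal z) f x - 0"
    by (intro tendsto_intros)
  then show "(\<lambda>n. threshold_value (ereal (s n)) f x) \<longlonglongrightarrow> threshold_value (ereal z) f x"
    by (simp add: D_def)
qed simp

end

section \<open>Disintegration of the induced measures\<close>

text \<open>The extension is \<open>mp_index\<close> composed with the clamping map \<open>c\<close>
  of the line onto the state interval, and \<open>c\<close> is monotone.\<close>

lemma mono_mp_index_ext:
  assumes "lower P < upper P" and mono: "mono_on (states P) (mp_index P)"
  shows "mono (mp_index_ext P)"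
proof -
  define c where "c z = (if ereal z < lower P then real_of_ereal (lower P)
      else if upper P < ereal z then real_of_ereal (upper P) else z)" for z
  \<comment> \<open>A real number below \<open>lower P\<close>, together with
    \<open>lower P < upper P\<close>, forces the end point to be finite, so
    \<open>real_of_ereal\<close> returns its true value.\<close>
  have low: "ereal (real_of_ereal (lower P)) = lower P" if "ereal z < lower P" for z
    using that assms(1) by (cases "lower P") auto
  have up: "ereal (real_of_ereal (upper P)) = upper P" if "upper P < ereal z" for z
    using that assms(1) by (cases "upper P") auto
  have c: "c z \<in> states P" for z
    using low[of z] up[of z] assms(1) by (auto simp: c_def states_def)
  have c_mono: "c x \<le> c y" if "x \<le> y" for x y
    using that assms(1) by (cases "lower P"; cases "upper P") (auto simp: c_def)
  have eq: "mp_index_ext P z = mp_index P (c z)" for z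
    by (simp add: mp_index_ext_def c_def)
  show ?thesis
    unfolding eq[abs_def] by (intro monoI mono_onD[OF mono] c c_mono)
qed

section \<open>The metrics of an indexable project as a dominated monotone family\<close>

context project_model
begin

lemma F_metric_dirac: "x \<in> S \<Longrightarrow> F_metric P (dirac P x) (threshold z) = threshold_value z (reward P) x"
  unfolding F_metric_def by (rule total_discounted_threshold_dirac[OF _ weight_bounded_reward])

lemma G_metric_dirac: "x \<in> S \<Longrightarrow> G_metric P (dirac P x) (threshold z) = threshold_value z (resource P) x"
  unfolding G_metric_def by (rule total_discounted_threshold_dirac[OF _ weight_bounded_resource])

lemma g_marginal_eq_advantage: "x \<in> S \<Longrightarrow> g_marginal P x (threshold z) = advantage z (resource P) x"
  unfolding g_marginal_def G_metric_def advantage_def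
  by (simp add: total_discounted_first_then[OF _ weight_bounded_resource])

context
  fixes \<nu> :: "real measure"
  assumes indexable: "PCL_indexable P" and \<nu>: "\<nu> \<in> prob_w P w"
begin

abbreviation "m \<equiv> mp_index_ext P"

text \<open>The sign makes the nonincreasing resource metric an admissible generator for
  \<open>interval_measure\<close>. The same sign in \<open>neg_F\<close> absorbs the minus in
  \<open>stieltjes_integral_antimono\<close>.\<close>

definition neg_G :: "real \<Rightarrow> real \<Rightarrow> real" where
  "neg_G x z = - threshold_value (ereal z) (resource P) x"

definition neg_F :: "real \<Rightarrow> real \<Rightarrow> real" where
  "neg_F x z = - threshold_value (ereal z) (reward P) x"

definition metric_bound :: "real \<Rightarrow> real" where
  "metric_bound x = M / (1 - \<gamma>) * w x"

definition mixture :: "real measure" where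
  "mixture = interval_measure (\<lambda>z. \<integral>x. neg_G x z \<partial>\<nu>)"

lemma sets_initial: "sets \<nu> = sets N" and space_initial: "space \<nu> = S"
  using \<nu> by (auto simp: prob_w_def space_prob_algebra dest: sets_eq_imp_space_eq)

lemma advantage_pos: "x \<in> S \<Longrightarrow> 0 < advantage z (resource P) x"
  using indexable by (simp add: PCL_indexable_def g_marginal_eq_advantage[symmetric])

text \<open>Collects the hypotheses of the mixture lemmas in the order in which these take them;
  \<open>index_mono\<close> goes in before the last one.\<close>

lemma metric_family:
  shows "(\<lambda>x. neg_G x z) \<in> borel_measurable \<nu>" "(\<lambda>x. neg_F x z) \<in> borel_measurable \<nu>"
    and "integrable \<nu> metric_bound"
    and "x \<in> space \<nu> \<Longrightarrow> \<bar>neg_G x z\<bar> \<le> metric_bound x" "x \<in> space \<nu> \<Longrightarrow> \<bar>neg_F x z\<bar> \<le> metric_bound x"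
    and "x \<in> space \<nu> \<Longrightarrow> mono (neg_G x)"
    and "x \<in> space \<nu> \<Longrightarrow> continuous (at_right a) (neg_G x)"
    and "x \<in> space \<nu> \<Longrightarrow> a < b \<Longrightarrow> neg_F x b - neg_F x a = (LINT z:{a<..b}|interval_measure (neg_G x). m z)"
proof -
  show "(\<lambda>x. neg_G x z) \<in> borel_measurable \<nu>" "(\<lambda>x. neg_F x z) \<in> borel_measurable \<nu>"
    using threshold_value_measurable[OF weight_bounded_resource] threshold_value_measurable[OF weight_bounded_reward]
    by (simp_all add: neg_G_def neg_F_def measurable_cong_sets[OF sets_initial refl])
  have "(\<integral>\<^sup>+x. ennreal \<bar>w x\<bar> \<partial>\<nu>) = (\<integral>\<^sup>+x. ennreal (w x) \<partial>\<nu>)"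
    using weight_ge_1 by (intro nn_integral_cong) (force simp: space_initial)
  then have "integrable \<nu> w"
    using \<nu> by (simp add: integrable_iff_bounded measurable_cong_sets[OF sets_initial refl] prob_w_def)
  then show "integrable \<nu> metric_bound"
    unfolding metric_bound_def by (rule integrable_mult_right)
  show "\<bar>neg_G x z\<bar> \<le> metric_bound x" "\<bar>neg_F x z\<bar> \<le> metric_bound x" if "x \<in> space \<nu>"
    using that threshold_value_bound[OF weight_bounded_resource] threshold_value_bound[OF weight_bounded_reward]
    by (simp_all add: neg_G_def neg_F_def metric_bound_def space_initial)
  show "mono (neg_G x)" if "x \<in> space \<nu>"
    using threshold_value_antimono[OF weight_bounded_resource advantage_pos, of x] that
    by (auto simp: mono_def neg_G_def space_initial)
  show "continuous (at_right a) (neg_G x)" if "x \<in> space \<nu>"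
    unfolding neg_G_def
    using threshold_value_right_continuous[OF weight_bounded_resource advantage_pos, of x] that
    by (intro continuous_minus) (simp add: space_initial)
  show "neg_F x b - neg_F x a = (LINT z:{a<..b}|interval_measure (neg_G x). m z)" if x: "x \<in> space \<nu>" and ab: "a < b"
  proof -
    have "x \<in> S" using x by (simp add: space_initial)
    moreover have "F_metric P (dirac P x) (threshold (ereal b)) - F_metric P (dirac P x) (threshold (ereal a))
        = stieltjes_integral_antimono (\<lambda>z. G_metric P (dirac P x) (threshold (ereal z))) m {a<..b}"
      using indexable \<open>x \<in> S\<close> ab by (simp add: PCL_indexable_def)
    ultimately show ?thesis
      by (simp add: F_metric_dirac G_metric_dirac stieltjes_integral_antimono_def neg_F_def neg_G_def[abs_def])
  qed
qed

lemma index_mono: "mono m"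
  using indexable standing by (intro mono_mp_index_ext) (auto simp: PCL_indexable_def standing_assumption_def)

lemma G_metric_initial: "G_metric P \<nu> (threshold (ereal z)) = - (\<integral>x. neg_G x z \<partial>\<nu>)"
  unfolding G_metric_def neg_G_def by (simp add: total_discounted_threshold[OF \<nu> weight_bounded_resource])

lemma F_metric_initial: "F_metric P \<nu> (threshold (ereal z)) = - (\<integral>x. neg_F x z \<partial>\<nu>)"
  unfolding F_metric_def neg_F_def by (simp add: total_discounted_threshold[OF \<nu> weight_bounded_reward])

lemma integrable_index: "integrable mixture m"
  unfolding mixture_def
  by (rule integrable_mixture_density[OF _ metric_family(1-7) index_mono metric_family(8)])
     (use states_nonempty in \<open>simp_all add: space_initial\<close>)

lemma integral_index:
  assumes "a < b"
  shows "(LINT z:{a<..b}|mixture. m z) = F_metric P \<nu> (threshold (ereal a)) - F_metric P \<nu> (threshold (ereal b))"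
proof -
  have "(\<integral>x. neg_F x b \<partial>\<nu>) - (\<integral>x. neg_F x a \<partial>\<nu>) = (LINT z:{a<..b}|mixture. m z)"
    unfolding mixture_def
    by (rule integral_mixture_density[OF _ metric_family(1-7) index_mono metric_family(8) assms])
       (use states_nonempty in \<open>simp_all add: space_initial\<close>)
  then show ?thesis by (simp add: F_metric_initial)
qed

text \<open>Discharges the definite description: the integrated bound \<open>metric_bound\<close>
  makes the mixture finite, and the values on half-open intervals determine it.\<close>

lemma G_measure_eq: "G_measure P \<nu> = mixture"
  unfolding G_measure_def
proof (rule the_equality)
  let ?h = "\<lambda>z. \<integral>x. neg_G x z \<partial>\<nu>"
  have h: "mono ?h" "continuous (at_right a) ?h" for a
    by (rule mono_integral_family[OF metric_family(1,3,4,6)] right_continuous_integral_family[OF metric_family(1,3,4,7)], assumption+)+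
  have bd: "\<bar>?h z\<bar> \<le> (\<integral>x. metric_bound x \<partial>\<nu>)" for z
    by (rule integral_family_bound[OF metric_family(1,3,4)])
  have fin: "finite_measure mixture"
  proof
    have "emeasure mixture UNIV \<le> ennreal (2 * (\<integral>x. metric_bound x \<partial>\<nu>))"
      unfolding mixture_def
      by (rule emeasure_interval_measure_UNIV_le[OF h bd])
    then show "emeasure mixture (space mixture) \<noteq> \<infinity>"
      by (auto simp: mixture_def top_unique)
  qed
  show *: "sets mixture = sets borel \<and> finite_measure mixture \<and>
     (\<forall>z1 z2. z1 < z2 \<longrightarrow> measure mixture {z1<..z2} =
        G_metric P \<nu> (threshold (ereal z1)) - G_metric P \<nu> (threshold (ereal z2)))"
    using fin monoD[OF h(1)] h(2) by (auto simp: mixture_def G_metric_initial measure_interval_measure_Ioc)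
  fix \<rho> assume \<rho>: "sets \<rho> = sets borel \<and> finite_measure \<rho> \<and>
     (\<forall>z1 z2. z1 < z2 \<longrightarrow> measure \<rho> {z1<..z2} =
        G_metric P \<nu> (threshold (ereal z1)) - G_metric P \<nu> (threshold (ereal z2)))"
  show "\<rho> = mixture"
    using \<rho> * by (intro measure_eqI_Ioc) (auto simp: finite_measure.emeasure_eq_measure)
qed

text \<open>The indefinite integral of \<open>m\<close> is a finite signed measure with the
  prescribed increments, by \<open>integral_index\<close>, and these increments determine
  it.\<close>

lemma F_measure_eq:
  "F_measure P \<nu> = (\<lambda>A. if A \<in> sets borel then LINT z:A|mixture. m z else 0)"
  unfolding F_measure_def
proof (rule the_equality)
  let ?\<phi> = "\<lambda>A. if A \<in> sets borel then LINT z:A|mixture. m z else 0"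
  have s: "sets mixture = sets borel" by (simp add: mixture_def)
  have "finite_signed_measure borel ?\<phi>"
    using finite_signed_measure_density[OF integrable_index] by (simp add: finite_signed_measure_def s)
  then show *: "finite_signed_measure borel ?\<phi> \<and>
     (\<forall>z1 z2. z1 < z2 \<longrightarrow> ?\<phi> {z1<..z2} =
        F_metric P \<nu> (threshold (ereal z1)) - F_metric P \<nu> (threshold (ereal z2)))"
    by (simp add: integral_index)
  fix \<rho> assume \<rho>: "finite_signed_measure borel \<rho> \<and>
     (\<forall>z1 z2. z1 < z2 \<longrightarrow> \<rho> {z1<..z2} =
        F_metric P \<nu> (threshold (ereal z1)) - F_metric P \<nu> (threshold (ereal z2)))"
  show "\<rho> = ?\<phi>"
    using \<rho> * by (intro finite_signed_measure_eqI_Ioc) auto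
qed

end
end

text \<open>Both induced measures are now explicit, and absolute continuity holds because integrals
  over null sets vanish. Integrability belongs to the conclusion because a Bochner integral defaults
  to 0 when the integrand is not integrable.\<close>

theorem proposition4:
  fixes P :: project and w :: "real \<Rightarrow> real" and M \<gamma> :: real and \<nu>0 :: "real measure"
  assumes "standing_assumption P w M \<gamma>"
    and "PCL_indexable P"
    and "\<nu>0 \<in> prob_w P w"
  shows "abs_continuous_signed (G_measure P \<nu>0) (F_measure P \<nu>0) \<and>
         integrable (G_measure P \<nu>0) (mp_index_ext P) \<and>
         (\<forall>S\<in>sets borel.
            F_measure P \<nu>0 S = (LINT x:S|G_measure P \<nu>0. mp_index_ext P x))"
proof -
  interpret project_model P w M \<gamma>
    by standard (rule assms(1))
  have Geq: "G_measure P \<nu>0 = mixture \<nu>0"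
    by (rule G_measure_eq[OF assms(2,3)])
  have Feq: "F_measure P \<nu>0 A = (LINT x:A|G_measure P \<nu>0. mp_index_ext P x)" if "A \<in> sets borel" for A
    using that by (simp add: F_measure_eq[OF assms(2,3)] Geq)
  have s: "sets (G_measure P \<nu>0) = sets borel"
    by (simp add: Geq mixture_def[OF assms(2,3)])
  have "F_measure P \<nu>0 A = 0" if "A \<in> null_sets (G_measure P \<nu>0)" for A
  proof -
    have "A \<in> sets borel" using that s by (auto simp: null_sets_def)
    moreover have "(LINT x:A|G_measure P \<nu>0. mp_index_ext P x) = 0"
      unfolding set_lebesgue_integral_def
      using AE_not_in[OF that] by (intro integral_eq_zero_AE) (auto elim!: eventually_mono)
    ultimately show ?thesis
      by (simp add: Feq)
  qed
  then show ?thesis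
    using integrable_index[OF assms(2,3)] Feq by (simp add: abs_continuous_signed_def Geq)
qed

end
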